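(* Let $B\subseteq\mathbb{R}^n$ be a compact set, let $\mu$ be a finite measure supported on $B$, let $T:\mathbb{R}^n\to\mathbb{R}^m$ be a polynomial map with components $T_i(x_1,\dots,x_n)$, $1\le i\le m$, and for $k\ge0$ let $Q_k:=\{\lambda\in\mathbb{R}^m:\phi^k_\lambda\succeq0\}$. The following statements hold: (1) For every $k$, $Q_{k+1}\subseteq Q_k$, the set $Q_k$ is a spectrahedron, and $Q_k^\circ$ is an SDR set. (2) $\mathrm{Conv}(T(B))^\circ\subseteq Q_k$ for every $k$. (3) $\mathrm{Conv}(T(B))^\circ=\bigcap_{k=1}^\infty Q_k$. (4) $\mathrm{Conv}(T(B))=\overline{\bigcup_k(Q_k^\circ)}$. (5) If $B$ is a finite set and $\mu$ is the counting measure on $B$, then $\mathrm{Conv}(T(B))=Q_k^\circ$ for some $k$.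
   Context: "$\mu$ is supported on $B$" means that every open neighborhood of every point of $B$ has positive $\mu$-measure. For $\lambda\in\mathbb{R}^m$ and an integer $k\ge0$, $\phi^k_\lambda$ is the symmetric bilinear form on the vector space of real polynomials of degree at most $k$ on $\mathbb{R}^n$ given by $$\phi^k_\lambda(a(x),b(x)):=\int_B\Big(1+\sum_{i=1}^m\lambda_iT_i(x)\Big)a(x)b(x)\,d\mu(x),$$ and $\phi^k_\lambda\succeq0$ means that it is positive semidefinite. $\mathrm{Conv}$ denotes convex hull and the overline denotes closure. The polar of $S\subseteq\mathbb{R}^m$ is $S^\circ=\{\lambda\in\mathbb{R}^m:\sum_i\lambda_iy_i\ge-1\ \text{for all }y\in S\}$. A spectrahedron in $\mathbb{R}^m$ is a set of the form $\{x\in\mathbb{R}^m:M_0+\sum_{i=1}^m x_iM_i\succeq0\}$ for some symmetric matrices $M_0,\dots,M_m$; an SDR set in $\mathbb{R}^m$ is a set of the form $\{x\in\mathbb{R}^m:\exists y\in\mathbb{R}^l\ (M_0+\sum_{i=1}^m x_iM_i+\sum_{j=1}^l y_jN_j\succeq0)\}$ for some $l$ and some symmetric matrices $M_0,\dots,M_m,N_1,\dots,N_l$.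
   Formalization: (4) and (5) are stated under the added hypothesis 0 ∈ Conv(T(B)), without which both fail since every polar contains 0; μ is a Borel measure on B itself, with "supported on B" meaning relatively open neighborhoods in B have positive measure, as mass outside B would break (3). *)

theory Defs
  imports "HOL-Analysis.Analysis"
begin

text \<open>Open neighbourhoods are taken in the subspace topology of \<open>B\<close>; this is used for
  Borel measures \<open>\<mu>\<close> whose underlying space is \<open>B\<close> itself.\<close>

definition supported_on :: "'a::topological_space measure \<Rightarrow> 'a set \<Rightarrow> bool" where
  "supported_on \<mu> B \<longleftrightarrow>
     (\<forall>x\<in>B. \<forall>U. openin (top_of_set B) U \<and> x \<in> U \<longrightarrow> emeasure \<mu> U > 0)"

text \<open>Real polynomials in \<open>n\<close> variables of total degree at most \<open>k\<close>, identified with the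
  functions they define; \<open>\<alpha>\<close> ranges over the (finitely many) exponent vectors of the monomials
  of degree at most \<open>k\<close>.\<close>

definition polys_deg_le :: "nat \<Rightarrow> (real^'n \<Rightarrow> real) set" where
  "polys_deg_le k =
     {p. \<exists>c. p = (\<lambda>x. \<Sum>\<alpha> | (\<Sum>i\<in>UNIV. \<alpha> i) \<le> k. c \<alpha> * (\<Prod>i\<in>UNIV. (x $ i) ^ \<alpha> i))}"

definition phi ::
    "(real^'n) set \<Rightarrow> (real^'n) measure \<Rightarrow> (real^'n \<Rightarrow> real^'m) \<Rightarrow> real^'m
      \<Rightarrow> (real^'n \<Rightarrow> real) \<Rightarrow> (real^'n \<Rightarrow> real) \<Rightarrow> real" where
  "phi B \<mu> T l a b = (LINT x:B|\<mu>. (1 + (\<Sum>i\<in>UNIV. l $ i * T x $ i)) * a x * b x)"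

definition psd_form_on :: "'v set \<Rightarrow> ('v \<Rightarrow> 'v \<Rightarrow> real) \<Rightarrow> bool" where
  "psd_form_on V f \<longleftrightarrow> (\<forall>a\<in>V. f a a \<ge> 0)"

definition Q ::
    "(real^'n) set \<Rightarrow> (real^'n) measure \<Rightarrow> (real^'n \<Rightarrow> real^'m) \<Rightarrow> nat \<Rightarrow> (real^'m) set" where
  "Q B \<mu> T k = {l. psd_form_on (polys_deg_le k) (phi B \<mu> T l)}"

definition polar :: "(real^'m) set \<Rightarrow> (real^'m) set" where
  "polar S = {l. \<forall>y\<in>S. (\<Sum>i\<in>UNIV. l $ i * y $ i) \<ge> -1}"

text \<open>As the size \<open>d\<close> of the matrices is existentially quantified below, a \<open>d \<times> d\<close> matrix is
  represented by a function of which only the entries with both indices below \<open>d\<close> matter.\<close>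

definition sym_matrix :: "nat \<Rightarrow> (nat \<Rightarrow> nat \<Rightarrow> real) \<Rightarrow> bool" where
  "sym_matrix d A \<longleftrightarrow> (\<forall>p<d. \<forall>q<d. A p q = A q p)"

definition psd_matrix :: "nat \<Rightarrow> (nat \<Rightarrow> nat \<Rightarrow> real) \<Rightarrow> bool" where
  "psd_matrix d A \<longleftrightarrow> sym_matrix d A \<and> (\<forall>v. (\<Sum>p<d. \<Sum>q<d. v p * A p q * v q) \<ge> 0)"

definition spectrahedron :: "(real^'m) set \<Rightarrow> bool" where
  "spectrahedron S \<longleftrightarrow>
     (\<exists>d M0 (M :: 'm \<Rightarrow> nat \<Rightarrow> nat \<Rightarrow> real).
        sym_matrix d M0 \<and> (\<forall>i. sym_matrix d (M i)) \<and>
        S = {x. psd_matrix d (\<lambda>p q. M0 p q + (\<Sum>i\<in>UNIV. x $ i * M i p q))})"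

definition SDR_set :: "(real^'m) set \<Rightarrow> bool" where
  "SDR_set S \<longleftrightarrow>
     (\<exists>d l M0 (M :: 'm \<Rightarrow> nat \<Rightarrow> nat \<Rightarrow> real) (N :: nat \<Rightarrow> nat \<Rightarrow> nat \<Rightarrow> real).
        sym_matrix d M0 \<and> (\<forall>i. sym_matrix d (M i)) \<and> (\<forall>j<l. sym_matrix d (N j)) \<and>
        S = {x. \<exists>y :: nat \<Rightarrow> real.
               psd_matrix d (\<lambda>p q. M0 p q + (\<Sum>i\<in>UNIV. x $ i * M i p q) + (\<Sum>j<l. y j * N j p q))})"

end

theory Submission
  imports Defs
begin

text \<open>Write \<open>f\<^sub>l = 1 + \<Sum>\<^sub>i l\<^sub>i T\<^sub>i\<close> for \<open>l\<close> in \<open>real^'m\<close>. Membership of \<open>l\<close> in the polar of the image of \<open>T\<close>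
  means \<open>f\<^sub>l \<ge> 0\<close> on \<open>B\<close>, and passing to the convex hull changes no polar. Membership in \<open>Q\<^sub>k\<close> is the
  weaker condition \<open>\<integral> f\<^sub>l a\<^sup>2 \<ge> 0\<close> for all polynomials \<open>a\<close> of degree at most \<open>k\<close>. The inclusions
  between these sets are immediate.

  If \<open>l\<close> lies in every \<open>Q\<^sub>k\<close>, then \<open>\<integral> f\<^sub>l p\<^sup>2 \<ge> 0\<close> for all polynomials \<open>p\<close>, hence, by the
  Stone-Weierstrass theorem, also with the continuous function \<open>g = max 0 (- f\<^sub>l)\<close> in place of \<open>p\<close>. But
  \<open>f\<^sub>l g\<^sup>2 = - g\<^sup>3 \<le> 0\<close>, so the integral of \<open>g\<^sup>3\<close> vanishes. A nonnegative continuous function whose integral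
  vanishes is zero on \<open>B\<close>, because every relatively open nonempty set has positive measure; thus
  \<open>g = 0\<close> and \<open>f\<^sub>l \<ge> 0\<close> (\<open>nonneg_if_square_integrals_nonneg\<close>). This gives the equality of
  the intersection with the polar. The closure statement follows by taking polars of both sides with
  the bipolar theorem, and for this \<open>Q\<^sub>k\<close> has to be its own bipolar and the hull has to contain
  the origin. When \<open>B\<close> is finite and carries the counting measure, polynomials of some fixed degree
  suffice to isolate each point of \<open>B\<close>, and the integral against the square of such a polynomial is
  a positive multiple of one value of \<open>f\<^sub>l\<close>; so \<open>Q\<^sub>k\<close> is already the polar of the image.

  The semidefinite representation rests on the choice of basis. The form \<open>\<integral> a b\<close> may be degenerate on
  polynomials, but it degenerates exactly on those that vanish on \<open>B\<close>, which do not matter for any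
  of the forms \<open>\<integral> f\<^sub>l a b\<close>. The Gram-Schmidt process therefore provides finitely many orthonormal
  polynomials of degree at most \<open>k\<close> that span all polynomials of degree at most \<open>k\<close> as functions on \<open>B\<close>
  (\<open>orthonormal_spanning_family\<close>). With respect to them, \<open>Q\<^sub>k\<close> is the set of all \<open>l\<close> for
  which \<open>I + \<Sum>\<^sub>i l\<^sub>i M\<^sub>i\<close> is positive semidefinite, where \<open>M\<^sub>i\<close> is the matrix of the form \<open>\<integral> T\<^sub>i a b\<close>.

  Having the identity \<open>I\<close> as constant term makes the duality exact. The set \<open>S\<close> of the vectors
  \<open>(v\<^sup>T M\<^sub>i v)\<^sub>i\<close> with \<open>v\<close> on the unit sphere is compact and has \<open>Q\<^sub>k\<close> as its polar, so the polar of \<open>Q\<^sub>k\<close> is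
  the convex hull of \<open>S\<close> and the origin, with no closure needed. That hull consists of
  the vectors of all \<open>\<langle>W, M\<^sub>i\<rangle>\<close> with \<open>W\<close> positive semidefinite of trace at most one
  (\<open>polar_monic_spectrahedron\<close>), which is a description by linear matrix inequalities
  whose additional variables are the entries of \<open>W\<close>.\<close>

section \<open>Polynomials of bounded degree\<close>

definition monomial_fun :: "('n::finite \<Rightarrow> nat) \<Rightarrow> real^'n \<Rightarrow> real" where
  "monomial_fun \<alpha> x = (\<Prod>i\<in>UNIV. (x $ i) ^ \<alpha> i)"

lemma finite_exponents: "finite {\<alpha> :: 'n::finite \<Rightarrow> nat. (\<Sum>i\<in>UNIV. \<alpha> i) \<le> k}"
proof (rule finite_subset)
  show "{\<alpha> :: 'n \<Rightarrow> nat. (\<Sum>i\<in>UNIV. \<alpha> i) \<le> k} \<subseteq> (\<Pi>\<^sub>E i\<in>UNIV. {..k})"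
  proof
    fix \<alpha> :: "'n \<Rightarrow> nat"
    assume "\<alpha> \<in> {\<alpha>. (\<Sum>i\<in>UNIV. \<alpha> i) \<le> k}"
    moreover have "\<alpha> i \<le> (\<Sum>i\<in>UNIV. \<alpha> i)" for i
      by (intro member_le_sum) auto
    ultimately show "\<alpha> \<in> (\<Pi>\<^sub>E i\<in>UNIV. {..k})"
      by (auto intro: order_trans)
  qed
  show "finite (\<Pi>\<^sub>E i\<in>(UNIV :: 'n set). {..k})"
    by (intro finite_PiE) auto
qed

lemma polys_deg_le_iff:
  "p \<in> polys_deg_le k \<longleftrightarrow>
     (\<exists>c. p = (\<lambda>x. \<Sum>\<alpha> | (\<Sum>i\<in>UNIV. \<alpha> i) \<le> k. c \<alpha> * monomial_fun \<alpha> x))"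
  by (simp add: polys_deg_le_def monomial_fun_def)

lemma polys_deg_le_zero: "(\<lambda>x. 0) \<in> polys_deg_le k"
  unfolding polys_deg_le_iff by (intro exI[of _ "\<lambda>\<alpha>. 0"]) simp

lemma polys_deg_le_add_scaled:
  assumes "p \<in> polys_deg_le k" and "q \<in> polys_deg_le k"
  shows "(\<lambda>x. p x + c * q x) \<in> polys_deg_le k"
proof -
  obtain a b where
    "p = (\<lambda>x. \<Sum>\<alpha> | (\<Sum>i\<in>UNIV. \<alpha> i) \<le> k. a \<alpha> * monomial_fun \<alpha> x)"
    "q = (\<lambda>x. \<Sum>\<alpha> | (\<Sum>i\<in>UNIV. \<alpha> i) \<le> k. b \<alpha> * monomial_fun \<alpha> x)"
    using assms unfolding polys_deg_le_iff by blast
  then show ?thesis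
    unfolding polys_deg_le_iff
    by (intro exI[of _ "\<lambda>\<alpha>. a \<alpha> + c * b \<alpha>"])
       (simp add: sum.distrib sum_distrib_left algebra_simps)
qed

lemma polys_deg_le_scaled: "q \<in> polys_deg_le k \<Longrightarrow> (\<lambda>x. c * q x) \<in> polys_deg_le k"
  using polys_deg_le_add_scaled[OF polys_deg_le_zero, of q k c] by simp

lemma polys_deg_le_sum:
  assumes "finite I" and "\<And>i. i \<in> I \<Longrightarrow> p i \<in> polys_deg_le k"
  shows "(\<lambda>x. \<Sum>i\<in>I. c i * p i x) \<in> polys_deg_le k"
  using assms
proof (induction I rule: finite_induct)
  case empty
  show ?case by (simp add: polys_deg_le_zero)
next
  case (insert i I)
  then have "(\<lambda>x. (\<Sum>i\<in>I. c i * p i x) + c i * p i x) \<in> polys_deg_le k"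
    by (intro polys_deg_le_add_scaled) auto
  with insert.hyps show ?case by (simp add: add.commute)
qed

lemma monomial_in_polys_deg_le:
  assumes "(\<Sum>i\<in>UNIV. \<alpha> i) \<le> k"
  shows "monomial_fun \<alpha> \<in> polys_deg_le k"
  unfolding polys_deg_le_iff
proof (intro exI ext)
  fix x
  have "(\<Sum>\<beta> | (\<Sum>i\<in>UNIV. \<beta> i) \<le> k. (if \<beta> = \<alpha> then 1 else 0) * monomial_fun \<beta> x) =
        (\<Sum>\<beta> | (\<Sum>i\<in>UNIV. \<beta> i) \<le> k. if \<beta> = \<alpha> then monomial_fun \<beta> x else 0)"
    by (intro sum.cong) auto
  also have "\<dots> = monomial_fun \<alpha> x"
    using assms by (simp add: finite_exponents)
  finally show "monomial_fun \<alpha> x =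
      (\<Sum>\<beta> | (\<Sum>i\<in>UNIV. \<beta> i) \<le> k. (if \<beta> = \<alpha> then 1 else 0) * monomial_fun \<beta> x)" ..
qed

lemma polys_deg_le_mono:
  assumes "j \<le> k"
  shows "polys_deg_le j \<subseteq> polys_deg_le k"
proof
  fix p :: "real^'n \<Rightarrow> real"
  assume "p \<in> polys_deg_le j"
  then obtain c where p: "p = (\<lambda>x. \<Sum>\<alpha> | (\<Sum>i\<in>UNIV. \<alpha> i) \<le> j. c \<alpha> * monomial_fun \<alpha> x)"
    unfolding polys_deg_le_iff by blast
  show "p \<in> polys_deg_le k"
    unfolding p
    using assms by (intro polys_deg_le_sum finite_exponents monomial_in_polys_deg_le) auto
qed

lemma polys_deg_le_mult:
  assumes "p \<in> polys_deg_le j" and "q \<in> polys_deg_le k"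
  shows "(\<lambda>x. p x * q x) \<in> polys_deg_le (j + k)"
proof -
  let ?I = "\<lambda>k. {\<alpha>. (\<Sum>i\<in>UNIV. \<alpha> i) \<le> k}"
  obtain a b where
    p: "p = (\<lambda>x. \<Sum>\<alpha>\<in>?I j. a \<alpha> * monomial_fun \<alpha> x)" and
    q: "q = (\<lambda>x. \<Sum>\<beta>\<in>?I k. b \<beta> * monomial_fun \<beta> x)"
    using assms unfolding polys_deg_le_iff by blast
  have "(\<lambda>x. p x * q x) =
      (\<lambda>x. \<Sum>\<gamma>\<in>?I j \<times> ?I k. (a (fst \<gamma>) * b (snd \<gamma>)) * monomial_fun (\<lambda>i. fst \<gamma> i + snd \<gamma> i) x)"
    unfolding p q
    by (simp add: sum_product sum.cartesian_product case_prod_unfold monomial_fun_def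
        power_add prod.distrib mult_ac)
  also have "\<dots> \<in> polys_deg_le (j + k)"
    by (intro polys_deg_le_sum finite_cartesian_product finite_exponents monomial_in_polys_deg_le)
       (auto simp: sum.distrib)
  finally show ?thesis .
qed

lemma continuous_on_polys_deg_le:
  assumes "p \<in> polys_deg_le k"
  shows "continuous_on S p"
  using assms unfolding polys_deg_le_def
  by (auto intro!: continuous_intros)

text \<open>Polynomial functions are generated from linear functions and constants, without reference to a
  degree or to coordinates; a linear function is the combination of the coordinate monomials whose
  coefficients are its values on the standard basis.\<close>
lemma real_polynomial_function_in_polys_deg_le:
  fixes p :: "real^'n \<Rightarrow> real"
  assumes "real_polynomial_function p"
  shows "\<exists>k. p \<in> polys_deg_le k"
  using assms
proof induction
  case (linear f)
  interpret bounded_linear f by fact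
  have coord: "monomial_fun (\<lambda>j. if j = i then 1 else 0) x = x $ i" for i and x :: "real^'n"
  proof -
    have "monomial_fun (\<lambda>j. if j = i then 1 else 0) x = (\<Prod>j\<in>UNIV. if j = i then x $ j else 1)"
      unfolding monomial_fun_def by (intro prod.cong) auto
    then show ?thesis by simp
  qed
  have "f = (\<lambda>x. \<Sum>i\<in>UNIV. f (axis i 1) * monomial_fun (\<lambda>j. if j = i then 1 else 0) x)"
  proof
    fix x
    have "f x = f (\<Sum>i\<in>UNIV. (x $ i) *\<^sub>R axis i 1)"
      by (metis basis_expansion scalar_mult_eq_scaleR)
    then show "f x = (\<Sum>i\<in>UNIV. f (axis i 1) * monomial_fun (\<lambda>j. if j = i then 1 else 0) x)"
      by (simp add: sum scaleR coord mult.commute)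
  qed
  also have "\<dots> \<in> polys_deg_le 1"
    by (intro polys_deg_le_sum monomial_in_polys_deg_le) auto
  finally show ?case by blast
next
  case (const c)
  have "(\<lambda>x :: real^'n. c) = (\<lambda>x. c * monomial_fun (\<lambda>i. 0) x)"
    by (simp add: monomial_fun_def)
  also have "\<dots> \<in> polys_deg_le 0"
    by (intro polys_deg_le_scaled monomial_in_polys_deg_le) simp
  finally show ?case by blast
next
  case (add f g)
  then obtain j k where "f \<in> polys_deg_le j" "g \<in> polys_deg_le k" by blast
  then have "f \<in> polys_deg_le (max j k)" "g \<in> polys_deg_le (max j k)"
    using polys_deg_le_mono[of j "max j k"] polys_deg_le_mono[of k "max j k"] by auto
  then have "(\<lambda>x. f x + 1 * g x) \<in> polys_deg_le (max j k)"
    by (rule polys_deg_le_add_scaled)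
  then show ?case by auto
next
  case (mult f g)
  then show ?case using polys_deg_le_mult by blast
qed

section \<open>Polars\<close>

lemma polar_inner: "polar S = {l. \<forall>y\<in>S. - 1 \<le> l \<bullet> y}"
  by (simp add: polar_def inner_vec_def)

lemma polar_antimono: "S \<subseteq> S' \<Longrightarrow> polar S' \<subseteq> polar S"
  by (auto simp: polar_def)

lemma zero_in_polar: "0 \<in> polar S"
  by (simp add: polar_def)

text \<open>A polar is an intersection of closed half-spaces.\<close>
lemma closed_convex_polar: "closed (polar S)" "convex (polar S)"
proof -
  have eq: "polar S = (\<Inter>y\<in>S. {l. y \<bullet> l \<ge> - 1})"
    by (auto simp: polar_inner inner_commute)
  show "closed (polar S)"
    unfolding eq by (intro closed_INT ballI closed_halfspace_ge)
  show "convex (polar S)"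
    unfolding eq by (intro convex_INT convex_halfspace_ge)
qed

lemma polar_convex_hull: "polar (convex hull S) = polar S"
proof
  show "polar (convex hull S) \<subseteq> polar S"
    by (intro polar_antimono hull_subset)
  show "polar S \<subseteq> polar (convex hull S)"
  proof
    fix l assume "l \<in> polar S"
    then have "convex hull S \<subseteq> {y. l \<bullet> y \<ge> - 1}"
      by (intro hull_minimal convex_halfspace_ge) (auto simp: polar_inner)
    then show "l \<in> polar (convex hull S)"
      by (auto simp: polar_inner)
  qed
qed

lemma polar_insert_zero: "polar (insert 0 S) = polar S"
  by (auto simp: polar_def)

lemma polar_UN: "polar (\<Union>k\<in>K. S k) = (\<Inter>k\<in>K. polar (S k))"
  by (auto simp: polar_inner)

lemma polar_closure: "polar (closure S) = polar S"
proof
  show "polar (closure S) \<subseteq> polar S"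
    by (intro polar_antimono closure_subset)
  show "polar S \<subseteq> polar (closure S)"
  proof
    fix l assume "l \<in> polar S"
    then have "closure S \<subseteq> {y. l \<bullet> y \<ge> - 1}"
      by (intro closure_minimal closed_halfspace_ge) (auto simp: polar_inner)
    then show "l \<in> polar (closure S)"
      by (auto simp: polar_inner)
  qed
qed

text \<open>A hyperplane that strictly separates \<open>y\<close> from \<open>C\<close> has a negative offset because \<open>0 \<in> C\<close>, and can
  therefore be rescaled to offset \<open>- 1\<close>.\<close>
lemma separating_polar_element:
  assumes "closed C" "convex C" "0 \<in> C" "y \<notin> C"
  obtains l where "l \<in> polar C" "l \<bullet> y < - 1"
proof -
  obtain a b where ab: "a \<bullet> y < b" "\<And>x. x \<in> C \<Longrightarrow> a \<bullet> x > b"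
    using separating_hyperplane_closed_point[OF assms(2,1,4)] by blast
  from ab(2)[OF assms(3)] have "b < 0" by simp
  show thesis
  proof
    show "(1 / - b) *\<^sub>R a \<in> polar C"
      using ab(2) \<open>b < 0\<close> by (force simp: polar_inner field_simps)
    show "((1 / - b) *\<^sub>R a) \<bullet> y < - 1"
      using ab(1) \<open>b < 0\<close> by (simp add: field_simps)
  qed
qed

lemma bipolar:
  assumes "closed C" "convex C" "0 \<in> C"
  shows "polar (polar C) = C"
proof
  show "C \<subseteq> polar (polar C)"
    by (auto simp: polar_inner inner_commute)
  show "polar (polar C) \<subseteq> C"
  proof
    fix y assume y: "y \<in> polar (polar C)"
    show "y \<in> C"
    proof (rule ccontr)
      assume "y \<notin> C"
      then obtain l where "l \<in> polar C" "l \<bullet> y < - 1"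
        using separating_polar_element assms by blast
      with y show False by (fastforce simp: polar_inner inner_commute[of y l])
    qed
  qed
qed

section \<open>Positive semidefinite matrices\<close>

definition quad_form :: "nat \<Rightarrow> (nat \<Rightarrow> nat \<Rightarrow> real) \<Rightarrow> (nat \<Rightarrow> real) \<Rightarrow> real" where
  "quad_form d A v = (\<Sum>p<d. \<Sum>q<d. v p * A p q * v q)"

definition matrix_inner :: "nat \<Rightarrow> (nat \<Rightarrow> nat \<Rightarrow> real) \<Rightarrow> (nat \<Rightarrow> nat \<Rightarrow> real) \<Rightarrow> real" where
  "matrix_inner d A C = (\<Sum>p<d. \<Sum>q<d. A p q * C p q)"

lemma psd_matrix_iff: "psd_matrix d A \<longleftrightarrow> sym_matrix d A \<and> (\<forall>v. quad_form d A v \<ge> 0)"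
  by (simp add: psd_matrix_def quad_form_def)

lemma quad_form_cong:
  assumes "\<And>p q. p < d \<Longrightarrow> q < d \<Longrightarrow> A p q = C p q" and "\<And>p. p < d \<Longrightarrow> v p = w p"
  shows "quad_form d A v = quad_form d C w"
  unfolding quad_form_def using assms by (intro sum.cong refl) auto

lemma psd_matrix_cong:
  assumes "\<And>p q. p < d \<Longrightarrow> q < d \<Longrightarrow> A p q = C p q"
  shows "psd_matrix d A \<longleftrightarrow> psd_matrix d C"
proof -
  have "quad_form d A v = quad_form d C v" for v
    using assms by (intro quad_form_cong) auto
  with assms show ?thesis
    by (simp add: psd_matrix_iff sym_matrix_def)
qed

lemma quad_form_Suc:
  assumes "sym_matrix (Suc d) A"
  shows "quad_form (Suc d) A v =
    quad_form d A v + 2 * v d * (\<Sum>p<d. v p * A p d) + A d d * (v d)\<^sup>2"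
proof -
  have "(\<Sum>q<d. v d * A d q * v q) = v d * (\<Sum>p<d. v p * A p d)"
    using assms by (auto simp: sym_matrix_def sum_distrib_left mult_ac intro!: sum.cong)
  moreover have "(\<Sum>p<d. v p * A p d * v d) = v d * (\<Sum>p<d. v p * A p d)"
    by (auto simp: sum_distrib_left mult_ac intro!: sum.cong)
  ultimately show ?thesis
    by (simp add: quad_form_def sum.distrib power2_eq_square)
qed

lemma quad_form_rank_one: "quad_form d (\<lambda>p q. w p * w q) v = (\<Sum>p<d. v p * w p)\<^sup>2"
  by (simp add: quad_form_def power2_eq_square sum_product mult_ac)

text \<open>If the last diagonal entry vanishes, the quadratic form is affine in the last coordinate, so a
  nonzero entry in that column would make it negative somewhere.\<close>
lemma psd_matrix_zero_diagonal:
  assumes A: "psd_matrix (Suc d) A" and "A d d = 0" and "p < d"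
  shows "A p d = 0"
proof (rule ccontr)
  assume nz: "A p d \<noteq> 0"
  \<comment> \<open>The quadratic \<open>t\<^sup>2 A\<^sub>p\<^sub>p + 2 t A\<^sub>p\<^sub>d\<close> is negative at this \<open>t\<close>; the summand \<open>1\<close> only keeps the
    denominator positive.\<close>
  define t where "t = - A p d / (\<bar>A p p\<bar> + 1)"
  define v where "v = (\<lambda>q. if q = d then 1 else if q = p then t else 0)"
  have single: "(\<Sum>q<d. v q * f q) = t * f p" for f
  proof -
    have "(\<Sum>q<d. v q * f q) = (\<Sum>q<d. if q = p then t * f q else 0)"
      using \<open>p < d\<close> by (intro sum.cong) (auto simp: v_def)
    then show ?thesis using \<open>p < d\<close> by simp
  qed
  have "quad_form d A v = t * t * A p p"
    using single[of "\<lambda>q. t * A p q"] single[of "\<lambda>q. (\<Sum>r<d. v r * A q r)"]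
      single[of "\<lambda>r. A p r"]
    by (simp add: quad_form_def sum_distrib_left mult_ac)
  then have "quad_form (Suc d) A v = t * t * A p p + 2 * t * A p d"
    using A \<open>A d d = 0\<close> by (simp add: psd_matrix_iff quad_form_Suc single) (simp add: v_def)
  also have "\<dots> < 0"
  proof -
    define s where "s = \<bar>A p p\<bar> + 1"
    have s: "s > 0" "A p p < s" by (auto simp: s_def)
    have "A p d = - s * t" using s by (simp add: t_def flip: s_def)
    moreover have "t \<noteq> 0" using nz s by (simp add: t_def flip: s_def)
    ultimately have "t * t * A p p + 2 * t * A p d = t * t * (A p p - 2 * s)" "t * t > 0"
      by (auto simp: algebra_simps zero_less_mult_iff linorder_neq_iff)
    then show ?thesis using s by (simp add: mult_pos_neg)
  qed
  finally show False using A by (auto simp: psd_matrix_iff not_le[symmetric])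
qed

text \<open>Splitting off the rank-one matrix of the last column leaves the Schur complement \<open>C\<close>, which is
  positive semidefinite: the value of its form at \<open>v\<close> is the minimum of the form of \<open>A\<close> over the last
  coordinate, attained by \<open>u\<close>. If the last diagonal entry \<open>w\<close> is zero, so is the last
  column, and since division by zero yields zero the same formulas remain correct.\<close>
lemma psd_matrix_sum_rank_one:
  assumes "psd_matrix d A"
  shows "\<exists>a :: nat \<Rightarrow> nat \<Rightarrow> real. \<forall>p<d. \<forall>q<d. A p q = (\<Sum>j<d. a j p * a j q)"
  using assms
proof (induction d arbitrary: A)
  case 0
  then show ?case by simp
next
  case (Suc d)
  define w where "w = A d d"
  have sym: "sym_matrix (Suc d) A" and nonneg: "quad_form (Suc d) A v \<ge> 0" for v
    using Suc.prems by (auto simp: psd_matrix_iff)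
  have "0 \<le> quad_form (Suc d) A (\<lambda>p. if p = d then 1 else 0)"
    by (rule nonneg)
  also have "\<dots> = w"
    using sym by (subst quad_form_Suc) (simp_all add: w_def quad_form_def)
  finally have "w \<ge> 0" .
  have col: "A p d * A q d / w * w = A p d * A q d" if "p < d" for p q
    using psd_matrix_zero_diagonal[OF Suc.prems _ that] by (auto simp: w_def)
  define C where "C = (\<lambda>p q. A p q - A p d * A q d / w)"
  have "quad_form d C v \<ge> 0" for v
  proof -
    define s where "s = (\<Sum>p<d. v p * A p d)"
    define u where "u = (\<lambda>p. if p = d then - s / w else v p)"
    have "quad_form d C v = quad_form d A v - quad_form d (\<lambda>p q. A p d * A q d) v / w"
      by (simp add: quad_form_def C_def algebra_simps sum_subtractf sum_divide_distrib)
    also have "quad_form d (\<lambda>p q. A p d * A q d) v = s\<^sup>2"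
      by (simp add: quad_form_rank_one s_def)
    finally have "quad_form d C v = quad_form d A v - s\<^sup>2 / w" .
    moreover have "quad_form (Suc d) A u = quad_form d A v - s\<^sup>2 / w"
    proof -
      have "quad_form d A u = quad_form d A v" "(\<Sum>p<d. u p * A p d) = s"
        by (auto simp: quad_form_def u_def s_def intro!: sum.cong)
      then show ?thesis
        using sym by (subst quad_form_Suc)
          (auto simp: u_def w_def[symmetric] power2_eq_square field_simps)
    qed
    ultimately show ?thesis using nonneg[of u] by simp
  qed
  moreover have "sym_matrix d C"
    using sym by (auto simp: sym_matrix_def C_def)
  ultimately obtain a where a: "\<forall>p<d. \<forall>q<d. C p q = (\<Sum>j<d. a j p * a j q)"
    using Suc.IH[of C] by (auto simp: psd_matrix_iff)
  \<comment> \<open>Only the last vector involves the index \<open>d\<close>; it reproduces the last row and column of \<open>A\<close>.\<close>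
  define a' where
    "a' = (\<lambda>j p. if j < d then if p < d then a j p else 0 else A p d / sqrt w)"
  have "A p q = (\<Sum>j<Suc d. a' j p * a' j q)" if "p < Suc d" "q < Suc d" for p q
  proof -
    have last: "a' d p * a' d q = A p d * A q d / w"
      using \<open>w \<ge> 0\<close> by (simp add: a'_def)
    show ?thesis
    proof (cases "p < d \<and> q < d")
      case True
      then have "(\<Sum>j<d. a' j p * a' j q) = C p q"
        using a by (auto simp: a'_def intro!: sum.cong)
      with last show ?thesis by (simp add: C_def)
    next
      case False
      then have "(\<Sum>j<d. a' j p * a' j q) = 0"
        by (intro sum.neutral) (auto simp: a'_def)
      moreover have "A p q = A p d * A q d / w"
      proof (cases "q = d")
        case True
        then show ?thesis using col[of p p] that psd_matrix_zero_diagonal[OF Suc.prems, of p]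
          by (cases "p = d"; cases "w = 0") (auto simp: w_def)
      next
        case F: False
        then have "p = d" using False that by auto
        moreover have "A d q = A q d" using sym that by (auto simp: sym_matrix_def)
        ultimately show ?thesis using F that psd_matrix_zero_diagonal[OF Suc.prems, of q]
          by (cases "w = 0") (auto simp: w_def)
      qed
      ultimately show ?thesis using last by simp
    qed
  qed
  then show ?case by blast
qed

text \<open>Writing \<open>W\<close> as a sum of rank-one matrices turns the inner product into a sum of values of the
  quadratic form of \<open>A\<close>. This is the self-duality of the semidefinite cone in the direction needed for
  weak duality.\<close>
lemma matrix_inner_psd_nonneg:
  assumes "psd_matrix d W" and "psd_matrix d A"
  shows "matrix_inner d W A \<ge> 0"
proof -
  obtain a where a: "\<forall>p<d. \<forall>q<d. W p q = (\<Sum>j<d. a j p * a j q)"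
    using psd_matrix_sum_rank_one[OF assms(1)] by blast
  have "matrix_inner d W A = (\<Sum>p<d. \<Sum>q<d. \<Sum>j<d. a j p * A p q * a j q)"
    unfolding matrix_inner_def using a
    by (auto simp: sum_distrib_left sum_distrib_right mult_ac intro!: sum.cong)
  also have "\<dots> = (\<Sum>p<d. \<Sum>j<d. \<Sum>q<d. a j p * A p q * a j q)"
    by (intro sum.cong refl sum.swap)
  also have "\<dots> = (\<Sum>j<d. quad_form d A (a j))"
    unfolding quad_form_def by (rule sum.swap)
  also have "\<dots> \<ge> 0"
    using assms(2) by (intro sum_nonneg) (auto simp: psd_matrix_iff)
  finally show ?thesis .
qed

lemma psd_matrix_combination:
  assumes "psd_matrix d A" "psd_matrix d C" "s \<ge> 0" "t \<ge> 0"
  shows "psd_matrix d (\<lambda>p q. s * A p q + t * C p q)"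
proof -
  have "quad_form d (\<lambda>p q. s * A p q + t * C p q) v = s * quad_form d A v + t * quad_form d C v" for v
    by (simp add: quad_form_def sum.distrib sum_distrib_left algebra_simps)
  with assms show ?thesis
    by (auto simp: psd_matrix_iff sym_matrix_def)
qed

lemma psd_matrix_rank_one: "psd_matrix d (\<lambda>p q. w p * w q)"
  by (auto simp: psd_matrix_iff sym_matrix_def quad_form_rank_one)

lemma psd_matrix_block_diagonal:
  "psd_matrix (d + r) (\<lambda>p q. if p < d \<and> q < d then A p q else if p = q then D (p - d) else 0)
     \<longleftrightarrow> psd_matrix d A \<and> (\<forall>i<r. D i \<ge> 0)"
  (is "psd_matrix _ ?E \<longleftrightarrow> _")
proof -
  have split: "sum f {..<d + r} = sum f {..<d} + (\<Sum>i<r. f (d + i))" for f :: "nat \<Rightarrow> real"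
    by (simp add: lessThan_atLeast0 sum.atLeastLessThan_concat[of 0 d "d + r", symmetric]
        sum.shift_bounds_nat_ivl[of f 0 d r, simplified, symmetric] add.commute)
  have quad: "quad_form (d + r) ?E v = quad_form d A v + (\<Sum>i<r. D i * (v (d + i))\<^sup>2)" for v
  proof -
    have "(\<Sum>q<d + r. v p * ?E p q * v q) = (\<Sum>q<d. v p * A p q * v q)" if "p < d" for p
      unfolding split using that by (simp add: sum.neutral)
    moreover have "(\<Sum>q<d + r. v (d + i) * ?E (d + i) q * v q) = D i * (v (d + i))\<^sup>2"
      if "i < r" for i
    proof -
      have "(\<Sum>q<d + r. v (d + i) * ?E (d + i) q * v q) =
            (\<Sum>q<d + r. if q = d + i then D i * (v q)\<^sup>2 else 0)"
        by (intro sum.cong) (auto simp: power2_eq_square)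
      then show ?thesis using that by simp
    qed
    ultimately show ?thesis
      unfolding quad_form_def by (subst split) simp
  qed
  show ?thesis
  proof
    assume E: "psd_matrix (d + r) ?E"
    show "psd_matrix d A \<and> (\<forall>i<r. D i \<ge> 0)"
      unfolding psd_matrix_iff
    proof (intro conjI allI impI)
      show "sym_matrix d A"
        unfolding sym_matrix_def
      proof (intro allI impI)
        fix p q assume "p < d" "q < d"
        then show "A p q = A q p"
          using E unfolding psd_matrix_iff sym_matrix_def
          by (elim conjE) (drule spec[of _ p], drule mp, simp, drule spec[of _ q], simp)
      qed
    next
      fix v
      have "0 \<le> quad_form (d + r) ?E (\<lambda>p. if p < d then v p else 0)"
        using E by (simp only: psd_matrix_iff)
      also have "\<dots> = quad_form d A v"
        unfolding quad by (auto intro: quad_form_cong)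
      finally show "0 \<le> quad_form d A v" .
    next
      fix i assume "i < r"
      have "0 \<le> quad_form (d + r) ?E (\<lambda>p. if p = d + i then 1 else 0)"
        using E by (simp only: psd_matrix_iff)
      also have "\<dots> = (\<Sum>j<r. D j * (if j = i then 1 else 0)\<^sup>2)"
        unfolding quad by (simp add: quad_form_def)
      also have "\<dots> = (\<Sum>j<r. if j = i then D j else 0)"
        by (intro sum.cong) auto
      finally show "0 \<le> D i" using \<open>i < r\<close> by simp
    qed
  next
    assume AD: "psd_matrix d A \<and> (\<forall>i<r. D i \<ge> 0)"
    have "sym_matrix (d + r) ?E"
      using AD by (auto simp: psd_matrix_iff sym_matrix_def)
    moreover have "quad_form (d + r) ?E v \<ge> 0" for v
      unfolding quad using AD
      by (intro add_nonneg_nonneg sum_nonneg) (auto simp: psd_matrix_iff)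
    ultimately show "psd_matrix (d + r) ?E"
      unfolding psd_matrix_iff by blast
  qed
qed

text \<open>Scalar inequalities that are affine in \<open>x\<close> and \<open>y\<close> can be appended to a linear matrix inequality as
  additional diagonal entries. An element \<open>(c, a, b)\<close> of \<open>I\<close> encodes \<open>c + a \<bullet> x + \<Sum>\<^sub>j b\<^sub>j y\<^sub>j \<ge> 0\<close>.\<close>
lemma SDR_set_with_affine_inequalities:
  fixes M :: "'m::finite \<Rightarrow> nat \<Rightarrow> nat \<Rightarrow> real"
    and I :: "(real \<times> (real^'m) \<times> (nat \<Rightarrow> real)) set"
  assumes sym: "sym_matrix d M0" "\<And>i. sym_matrix d (M i)" "\<And>j. j < l \<Longrightarrow> sym_matrix d (N j)"
    and "finite I"
  shows "SDR_set {x. \<exists>y. psd_matrix d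
             (\<lambda>p q. M0 p q + (\<Sum>i\<in>UNIV. x $ i * M i p q) + (\<Sum>j<l. y j * N j p q))
           \<and> (\<forall>(c, a, b)\<in>I. c + (\<Sum>i\<in>UNIV. x $ i * a $ i) + (\<Sum>j<l. y j * b j) \<ge> 0)}"
proof -
  obtain r and h :: "nat \<Rightarrow> real \<times> (real^'m) \<times> (nat \<Rightarrow> real)" where I: "I = h ` {..<r}"
    using \<open>finite I\<close> by (auto simp: finite_conv_nat_seg_image lessThan_def)
  define block where "block = (\<lambda>(A :: nat \<Rightarrow> nat \<Rightarrow> real) D p q.
      if p < d \<and> q < d then A p q else if p = q then D (p - d) else (0 :: real))"
  define c a b where "c = (\<lambda>r. fst (h r))" and "a = (\<lambda>r. fst (snd (h r)))"
    and "b = (\<lambda>r. snd (snd (h r)))"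
  have sym_block: "sym_matrix (d + r) (block A D)" if "sym_matrix d A" for A D
    using that by (auto simp: sym_matrix_def block_def)
  have psd_block: "psd_matrix (d + r) (\<lambda>p q. block A D p q) \<longleftrightarrow>
      psd_matrix d A \<and> (\<forall>i<r. D i \<ge> 0)" for A D
    by (simp add: block_def psd_matrix_block_diagonal)
  have "block M0 c p q + (\<Sum>i\<in>UNIV. x $ i * block (M i) (\<lambda>r. a r $ i) p q)
        + (\<Sum>j<l. y j * block (N j) (\<lambda>r. b r j) p q)
      = block (\<lambda>p q. M0 p q + (\<Sum>i\<in>UNIV. x $ i * M i p q) + (\<Sum>j<l. y j * N j p q))
          (\<lambda>r. c r + (\<Sum>i\<in>UNIV. x $ i * a r $ i) + (\<Sum>j<l. y j * b r j)) p q" for x y p q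
    by (cases "p < d \<and> q < d"; cases "p = q") (auto simp: block_def)
  then have "psd_matrix (d + r) (\<lambda>p q. block M0 c p q
        + (\<Sum>i\<in>UNIV. x $ i * block (M i) (\<lambda>r. a r $ i) p q)
        + (\<Sum>j<l. y j * block (N j) (\<lambda>r. b r j) p q)) \<longleftrightarrow>
      psd_matrix d (\<lambda>p q. M0 p q + (\<Sum>i\<in>UNIV. x $ i * M i p q) + (\<Sum>j<l. y j * N j p q))
      \<and> (\<forall>(c, a, b)\<in>I. c + (\<Sum>i\<in>UNIV. x $ i * a $ i) + (\<Sum>j<l. y j * b j) \<ge> 0)" for x y
    by (simp only: psd_block I) (auto simp: c_def a_def b_def case_prod_unfold)
  then show ?thesis
    unfolding SDR_set_def
    by (intro exI[of _ "d + r"] exI[of _ l] exI[of _ "block M0 c"]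
        exI[of _ "\<lambda>i. block (M i) (\<lambda>r. a r $ i)"] exI[of _ "\<lambda>j. block (N j) (\<lambda>r. b r j)"])
       (auto simp: sym intro!: sym_block)
qed

section \<open>Polars of monic spectrahedra\<close>

definition identity_matrix :: "nat \<Rightarrow> nat \<Rightarrow> real" where
  "identity_matrix p q = (if p = q then 1 else 0)"

definition monic_spectrahedron :: "nat \<Rightarrow> ('m::finite \<Rightarrow> nat \<Rightarrow> nat \<Rightarrow> real) \<Rightarrow> (real^'m) set" where
  "monic_spectrahedron d M =
     {x. psd_matrix d (\<lambda>p q. identity_matrix p q + (\<Sum>i\<in>UNIV. x $ i * M i p q))}"

text \<open>For symmetric matrices this is their joint numerical range over the real unit sphere.\<close>
definition numerical_range :: "nat \<Rightarrow> ('m::finite \<Rightarrow> nat \<Rightarrow> nat \<Rightarrow> real) \<Rightarrow> (real^'m) set" where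
  "numerical_range d M = (\<lambda>v. \<chi> i. quad_form d (M i) v) ` {v. (\<Sum>p<d. (v p)\<^sup>2) = 1}"

lemma spectrahedron_monic:
  assumes "\<And>i. sym_matrix d (M i)"
  shows "spectrahedron (monic_spectrahedron d M)"
  unfolding spectrahedron_def monic_spectrahedron_def
  using assms by (intro exI[of _ d] exI[of _ identity_matrix] exI[of _ M])
    (auto simp: sym_matrix_def identity_matrix_def)

lemma matrix_inner_identity: "matrix_inner d W identity_matrix = (\<Sum>p<d. W p p)"
  by (simp add: matrix_inner_def identity_matrix_def if_distrib[of "\<lambda>x. _ * x"] cong: if_cong)

lemma matrix_inner_pencil:
  "matrix_inner d W (\<lambda>p q. A p q + (\<Sum>i\<in>UNIV. x $ i * M i p q)) =
     matrix_inner d W A + (\<Sum>i\<in>UNIV. x $ i * matrix_inner d W (M i))"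
proof -
  have "(\<Sum>p<d. \<Sum>q<d. \<Sum>i\<in>UNIV. x $ i * (W p q * M i p q)) =
        (\<Sum>i\<in>UNIV. \<Sum>p<d. \<Sum>q<d. x $ i * (W p q * M i p q))"
    by (subst sum.swap[of _ UNIV], subst (2) sum.swap) simp
  then show ?thesis
    by (simp add: matrix_inner_def algebra_simps sum.distrib sum_distrib_left)
qed

lemma matrix_inner_rank_one: "matrix_inner d (\<lambda>p q. v p * v q) A = quad_form d A v"
  by (simp add: matrix_inner_def quad_form_def mult_ac)

lemma quad_form_monic_pencil:
  "quad_form d (\<lambda>p q. identity_matrix p q + (\<Sum>i\<in>UNIV. x $ i * M i p q)) v =
     (\<Sum>p<d. (v p)\<^sup>2) + (\<Sum>i\<in>UNIV. x $ i * quad_form d (M i) v)"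
  by (simp add: matrix_inner_pencil matrix_inner_identity power2_eq_square
      flip: matrix_inner_rank_one)

lemma quad_form_scaled: "quad_form d A (\<lambda>p. c * v p) = c\<^sup>2 * quad_form d A v"
  by (simp add: quad_form_def sum_distrib_left power2_eq_square mult_ac)

text \<open>Positive semidefiniteness only has to be tested on unit vectors, where the identity contributes
  exactly \<open>1\<close> to the form; the resulting inequalities are those that define the polar.\<close>
lemma monic_spectrahedron_eq_polar:
  assumes "\<And>i. sym_matrix d (M i)"
  shows "monic_spectrahedron d M = polar (numerical_range d M)"
proof (intro set_eqI iffI)
  fix x assume x: "x \<in> monic_spectrahedron d M"
  show "x \<in> polar (numerical_range d M)"
    unfolding polar_def numerical_range_def
  proof safe
    fix v :: "nat \<Rightarrow> real" assume "(\<Sum>p<d. (v p)\<^sup>2) = 1"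
    moreover have "0 \<le> (\<Sum>p<d. (v p)\<^sup>2) + (\<Sum>i\<in>UNIV. x $ i * quad_form d (M i) v)"
      using x by (auto simp: monic_spectrahedron_def psd_matrix_iff simp flip: quad_form_monic_pencil)
    ultimately show "- 1 \<le> (\<Sum>i\<in>UNIV. x $ i * (\<chi> i. quad_form d (M i) v) $ i)"
      by simp
  qed
next
  fix x assume x: "x \<in> polar (numerical_range d M)"
  have "0 \<le> (\<Sum>p<d. (v p)\<^sup>2) + (\<Sum>i\<in>UNIV. x $ i * quad_form d (M i) v)" for v
  proof (cases "\<forall>p<d. v p = 0")
    case True
    then have "quad_form d A v = quad_form d A (\<lambda>p. 0)" for A
      by (intro quad_form_cong) auto
    then have "quad_form d A v = 0" for A by (simp add: quad_form_def)
    then show ?thesis by (simp add: sum_nonneg)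
  next
    case False
    define s where "s = (\<Sum>p<d. (v p)\<^sup>2)"
    have "s > 0" unfolding s_def using False by (auto intro!: sum_pos2)
    define u where "u = (\<lambda>p. (1 / sqrt s) * v p)"
    have "(\<Sum>p<d. (u p)\<^sup>2) = (1 / sqrt s)\<^sup>2 * s"
      unfolding u_def s_def by (simp only: power_mult_distrib sum_distrib_left)
    then have "(\<Sum>p<d. (u p)\<^sup>2) = 1"
      using \<open>s > 0\<close> by (simp add: power_divide)
    then have "- 1 \<le> (\<Sum>i\<in>UNIV. x $ i * quad_form d (M i) u)"
      using x by (auto simp: polar_def numerical_range_def)
    also have "\<dots> = (\<Sum>i\<in>UNIV. x $ i * quad_form d (M i) v) / s"
      unfolding u_def quad_form_scaled using \<open>s > 0\<close>
      by (simp add: power_divide sum_divide_distrib)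
    finally have "- s \<le> (\<Sum>i\<in>UNIV. x $ i * quad_form d (M i) v)"
      using \<open>s > 0\<close> by (simp add: field_simps)
    then show ?thesis by (simp add: s_def)
  qed
  then have "quad_form d (\<lambda>p q. identity_matrix p q + (\<Sum>i\<in>UNIV. x $ i * M i p q)) v \<ge> 0" for v
    by (simp add: quad_form_monic_pencil)
  moreover have "sym_matrix d (\<lambda>p q. identity_matrix p q + (\<Sum>i\<in>UNIV. x $ i * M i p q))"
    using assms by (auto simp: sym_matrix_def identity_matrix_def intro!: sum.cong)
  ultimately show "x \<in> monic_spectrahedron d M"
    by (simp add: monic_spectrahedron_def psd_matrix_iff)
qed

text \<open>The vectors are functions on all natural numbers, of which only the first \<open>d\<close> values enter. These
  can be confined to \<open>[-1, 1]\<close>, so the numerical range is the continuous image of a closed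
  subset of a cube, which is compact by Tychonoff's theorem.\<close>
lemma compact_numerical_range: "compact (numerical_range d M)"
proof -
  have cont_coord: "continuous_on K (\<lambda>v :: nat \<Rightarrow> real. v p)" for K p
    by (rule continuous_on_subset[OF continuous_on_product_coordinates subset_UNIV])
  define K where "K = (\<Pi>\<^sub>E p\<in>UNIV. {- 1..1 :: real}) \<inter> {v :: nat \<Rightarrow> real. (\<Sum>p<d. (v p)\<^sup>2) = 1}"
  have "compactin (product_topology (\<lambda>p :: nat. euclidean) UNIV) (\<Pi>\<^sub>E p\<in>UNIV. {- 1..1 :: real})"
    unfolding compactin_PiE by (simp add: compactin_euclidean_iff)
  then have "compact (\<Pi>\<^sub>E p\<in>(UNIV :: nat set). {- 1..1 :: real})"
    by (simp add: euclidean_product_topology compactin_euclidean_iff)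
  moreover have "closed {v :: nat \<Rightarrow> real. (\<Sum>p<d. (v p)\<^sup>2) = 1}"
    by (intro closed_Collect_eq continuous_on_sum continuous_on_power cont_coord continuous_on_const)
  ultimately have "compact K"
    unfolding K_def by (rule compact_Int_closed)
  moreover have "continuous_on K (\<lambda>v. \<chi> i. quad_form d (M i) v)"
    unfolding quad_form_def
    by (intro continuous_on_vec_lambda continuous_on_sum continuous_on_mult continuous_on_const cont_coord)
  moreover have "numerical_range d M = (\<lambda>v. \<chi> i. quad_form d (M i) v) ` K"
  proof
    show "(\<lambda>v. \<chi> i. quad_form d (M i) v) ` K \<subseteq> numerical_range d M"
      by (auto simp: numerical_range_def K_def)
    show "numerical_range d M \<subseteq> (\<lambda>v. \<chi> i. quad_form d (M i) v) ` K"
    proof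
      fix y assume "y \<in> numerical_range d M"
      then obtain v where v: "(\<Sum>p<d. (v p)\<^sup>2) = 1" "y = (\<chi> i. quad_form d (M i) v)"
        by (auto simp: numerical_range_def)
      \<comment> \<open>The values beyond \<open>d\<close> are arbitrary, so they have to be reset to reach the cube.\<close>
      define u where "u = (\<lambda>p. if p < d then v p else 0)"
      have "\<bar>v p\<bar> \<le> 1" if "p < d" for p
      proof -
        have "(v p)\<^sup>2 \<le> (\<Sum>p<d. (v p)\<^sup>2)"
          using that by (intro member_le_sum) auto
        with v show ?thesis by (simp add: abs_square_le_1)
      qed
      then have "u \<in> K"
        using v by (auto simp: K_def u_def abs_le_iff)
      moreover have "y = (\<chi> i. quad_form d (M i) u)"
        unfolding v(2) u_def by (simp add: vec_eq_iff) (intro allI quad_form_cong, auto)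
      ultimately show "y \<in> (\<lambda>v. \<chi> i. quad_form d (M i) v) ` K" by blast
    qed
  qed
  ultimately show ?thesis
    by (simp add: compact_continuous_image)
qed

text \<open>Elements of the right-hand side lie in the polar since the inner product of \<open>W\<close> with the positive
  semidefinite matrix \<open>I + \<Sum>\<^sub>i l\<^sub>i M\<^sub>i\<close> is nonnegative. Conversely, the polar is by the bipolar theorem the
  closed convex hull of the numerical range and the origin, which is the convex hull by compactness;
  the right-hand side is convex and contains both: take \<open>W = v v\<^sup>T\<close> and \<open>W = 0\<close>.\<close>
lemma polar_monic_spectrahedron:
  assumes sym: "\<And>i. sym_matrix d (M i)"
  shows "polar (monic_spectrahedron d M) =
    {x. \<exists>W. psd_matrix d W \<and> (\<Sum>p<d. W p p) \<le> 1 \<and> (\<forall>i. x $ i = matrix_inner d W (M i))}"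
    (is "_ = ?D")
proof
  show "?D \<subseteq> polar (monic_spectrahedron d M)"
  proof
    fix x assume "x \<in> ?D"
    then obtain W where W: "psd_matrix d W" "(\<Sum>p<d. W p p) \<le> 1"
      "\<And>i. x $ i = matrix_inner d W (M i)" by blast
    show "x \<in> polar (monic_spectrahedron d M)"
      unfolding polar_def
    proof safe
      fix l assume "l \<in> monic_spectrahedron d M"
      then have "0 \<le> matrix_inner d W (\<lambda>p q. identity_matrix p q + (\<Sum>i\<in>UNIV. l $ i * M i p q))"
        unfolding monic_spectrahedron_def using W(1) by (auto intro: matrix_inner_psd_nonneg)
      also have "\<dots> = (\<Sum>p<d. W p p) + (\<Sum>i\<in>UNIV. x $ i * l $ i)"
        by (simp add: matrix_inner_pencil matrix_inner_identity W(3) mult.commute)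
      finally show "- 1 \<le> (\<Sum>i\<in>UNIV. x $ i * l $ i)"
        using W(2) by linarith
    qed
  qed
next
  let ?S = "insert 0 (numerical_range d M)"
  have "compact (convex hull ?S)"
    by (intro compact_convex_hull compact_insert compact_numerical_range)
  then have "polar (polar (convex hull ?S)) = convex hull ?S"
    by (intro bipolar compact_imp_closed convex_convex_hull) (auto intro: hull_inc)
  then have "polar (monic_spectrahedron d M) = convex hull ?S"
    by (simp add: monic_spectrahedron_eq_polar[OF sym] polar_convex_hull polar_insert_zero)
  also have "\<dots> \<subseteq> ?D"
  proof (rule hull_minimal)
    show "?S \<subseteq> ?D"
    proof
      fix x assume "x \<in> ?S"
      then consider "x = 0" | v where "(\<Sum>p<d. (v p)\<^sup>2) = 1" "x = (\<chi> i. quad_form d (M i) v)"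
        by (auto simp: numerical_range_def)
      then show "x \<in> ?D"
      proof cases
        case 1
        have "psd_matrix d (\<lambda>p q. 0)" by (simp add: psd_matrix_def sym_matrix_def)
        then show ?thesis
          using 1 by (auto simp: matrix_inner_def intro!: exI[of _ "\<lambda>p q. 0"])
      next
        case 2
        then show ?thesis
          by (auto intro!: exI[of _ "\<lambda>p q. v p * v q"]
              simp: psd_matrix_rank_one matrix_inner_rank_one power2_eq_square)
      qed
    qed
    show "convex ?D"
    proof (rule convexI)
      fix x y and s t :: real
      assume "x \<in> ?D" "y \<in> ?D" and st: "0 \<le> s" "0 \<le> t" "s + t = 1"
      then obtain W Z where
        W: "psd_matrix d W" "(\<Sum>p<d. W p p) \<le> 1" "\<And>i. x $ i = matrix_inner d W (M i)" and
        Z: "psd_matrix d Z" "(\<Sum>p<d. Z p p) \<le> 1" "\<And>i. y $ i = matrix_inner d Z (M i)"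
        by blast
      have "(\<Sum>p<d. s * W p p + t * Z p p) = s * (\<Sum>p<d. W p p) + t * (\<Sum>p<d. Z p p)"
        by (simp add: sum.distrib sum_distrib_left)
      also have "\<dots> \<le> 1"
        using W(2) Z(2) st by (intro convex_bound_le)
      finally have "(\<Sum>p<d. s * W p p + t * Z p p) \<le> 1" .
      moreover have "(s *\<^sub>R x + t *\<^sub>R y) $ i = matrix_inner d (\<lambda>p q. s * W p q + t * Z p q) (M i)" for i
        by (simp add: W(3) Z(3) matrix_inner_def sum.distrib sum_distrib_left algebra_simps)
      ultimately show "s *\<^sub>R x + t *\<^sub>R y \<in> ?D"
        using psd_matrix_combination[OF W(1) Z(1) st(1,2)] by blast
    qed
  qed
  finally show "polar (monic_spectrahedron d M) \<subseteq> ?D" .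
qed

text \<open>The description by matrices \<open>W\<close> of trace at most one becomes a semidefinite representation by
  letting the entries of \<open>W\<close> be the additional variables, and by expressing each equation for a
  coordinate of \<open>x\<close> as two inequalities.\<close>
lemma SDR_set_polar_monic_spectrahedron:
  fixes M :: "'m::finite \<Rightarrow> nat \<Rightarrow> nat \<Rightarrow> real"
  assumes sym: "\<And>i. sym_matrix d (M i)"
  shows "SDR_set (polar (monic_spectrahedron d M))"
proof -
  \<comment> \<open>The variable with index \<open>p d + q\<close>, for \<open>p \<le> q\<close>, is the entry at \<open>(p, q)\<close> and at \<open>(q, p)\<close>; the
    variables with other indices do not enter the \<open>d \<times> d\<close> block.\<close>
  define N :: "nat \<Rightarrow> nat \<Rightarrow> nat \<Rightarrow> real"
    where "N = (\<lambda>j p q. if j = min p q * d + max p q then 1 else 0)"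
  define W where "W = (\<lambda>y p q. \<Sum>j<d * d. y j * N j p q)"
  have W_entry: "W y p q = y (min p q * d + max p q)" if "p < d" "q < d" for y p q
  proof -
    have "min p q * d + max p q < Suc (min p q) * d"
      using that by simp
    also have "\<dots> \<le> d * d"
      using that by (intro mult_le_mono1) simp
    finally have "min p q * d + max p q < d * d" .
    then show ?thesis
      by (simp add: W_def N_def if_distrib[of "\<lambda>x. _ * x"] cong: if_cong)
  qed
  have inner_W: "matrix_inner d (W y) A = (\<Sum>j<d * d. y j * matrix_inner d (N j) A)" for y A
  proof -
    have "matrix_inner d (W y) A = (\<Sum>p<d. \<Sum>q<d. \<Sum>j<d * d. y j * (N j p q * A p q))"
      by (simp add: matrix_inner_def W_def sum_distrib_right mult.assoc)
    also have "\<dots> = (\<Sum>j<d * d. \<Sum>p<d. \<Sum>q<d. y j * (N j p q * A p q))"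
      by (subst sum.swap[of _ "{..<d * d}"], subst (2) sum.swap) simp
    finally show ?thesis by (simp add: matrix_inner_def sum_distrib_left)
  qed
  have surj: "\<exists>y. \<forall>p<d. \<forall>q<d. Z p q = W y p q" if "sym_matrix d Z" for Z
  proof (intro exI[of _ "\<lambda>j. Z (j div d) (j mod d)"] allI impI)
    fix p q assume "p < d" "q < d"
    then show "Z p q = W (\<lambda>j. Z (j div d) (j mod d)) p q"
      using that by (simp add: W_entry) (auto simp: sym_matrix_def min_def max_def)
  qed
  define I :: "(real \<times> (real^'m) \<times> (nat \<Rightarrow> real)) set" where
    "I = insert (1, 0, \<lambda>j. - matrix_inner d (N j) identity_matrix)
      (range (\<lambda>i. (0, axis i 1, \<lambda>j. - matrix_inner d (N j) (M i))) \<union>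
       range (\<lambda>i. (0, - axis i 1, \<lambda>j. matrix_inner d (N j) (M i))))"
  have axis_sum: "(\<Sum>i\<in>UNIV. x $ i * axis k 1 $ i) = x $ k" for x :: "real^'m" and k
    by (simp add: axis_def if_distrib[of "\<lambda>x. _ * x"] cong: if_cong)
  have I_iff: "(\<forall>(c, a, b)\<in>I. c + (\<Sum>i\<in>UNIV. x $ i * a $ i) + (\<Sum>j<d * d. y j * b j) \<ge> 0) \<longleftrightarrow>
      (\<Sum>p<d. W y p p) \<le> 1 \<and> (\<forall>i. x $ i = matrix_inner d (W y) (M i))" for x y
  proof -
    have "(\<forall>(c, a, b)\<in>I. c + (\<Sum>i\<in>UNIV. x $ i * a $ i) + (\<Sum>j<d * d. y j * b j) \<ge> 0) \<longleftrightarrow>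
      (\<Sum>p<d. W y p p) \<le> 1 \<and> (\<forall>i. matrix_inner d (W y) (M i) \<le> x $ i) \<and>
      (\<forall>i. x $ i \<le> matrix_inner d (W y) (M i))"
      unfolding I_def
      by (simp add: ball_Un sum_negf axis_sum inner_W matrix_inner_identity[symmetric])
    then show ?thesis by (auto intro: order_antisym)
  qed
  have sym_N: "sym_matrix d (N j)" for j
    by (simp add: sym_matrix_def N_def min.commute max.commute)
  have "finite I" by (simp add: I_def)
  have "polar (monic_spectrahedron d M) = {x. \<exists>y. psd_matrix d (W y)
      \<and> (\<Sum>p<d. W y p p) \<le> 1 \<and> (\<forall>i. x $ i = matrix_inner d (W y) (M i))}"
    unfolding polar_monic_spectrahedron[OF sym]
  proof (intro Collect_cong iffI)
    fix x :: "real^'m"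
    assume "\<exists>Z. psd_matrix d Z \<and> (\<Sum>p<d. Z p p) \<le> 1 \<and> (\<forall>i. x $ i = matrix_inner d Z (M i))"
    then obtain Z where Z: "psd_matrix d Z" "(\<Sum>p<d. Z p p) \<le> 1"
      "\<And>i. x $ i = matrix_inner d Z (M i)" by blast
    then obtain y where y: "\<And>p q. p < d \<Longrightarrow> q < d \<Longrightarrow> Z p q = W y p q"
      using surj[of Z] by (auto simp: psd_matrix_iff)
    have "psd_matrix d (W y)" using Z(1) psd_matrix_cong[of d Z "W y"] y by simp
    moreover have "(\<Sum>p<d. W y p p) \<le> 1"
      using Z(2) sum.cong[of "{..<d}" "{..<d}" "\<lambda>p. Z p p" "\<lambda>p. W y p p"] y by simp
    moreover have "matrix_inner d Z A = matrix_inner d (W y) A" for A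
      unfolding matrix_inner_def using y by (intro sum.cong refl) auto
    ultimately show "\<exists>y. psd_matrix d (W y) \<and> (\<Sum>p<d. W y p p) \<le> 1
        \<and> (\<forall>i. x $ i = matrix_inner d (W y) (M i))"
      using Z(3) by auto
  qed blast
  also have "\<dots> = {x. \<exists>y. psd_matrix d
             (\<lambda>p q. 0 + (\<Sum>i\<in>UNIV. x $ i * 0) + (\<Sum>j<d * d. y j * N j p q))
           \<and> (\<forall>(c, a, b)\<in>I. c + (\<Sum>i\<in>UNIV. x $ i * a $ i) + (\<Sum>j<d * d. y j * b j) \<ge> 0)}"
    unfolding I_iff by (simp add: W_def)
  finally show ?thesis
    using SDR_set_with_affine_inequalities[of d "\<lambda>p q. 0" "\<lambda>i p q. 0" "d * d" N I] sym_N \<open>finite I\<close>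
    by (simp add: sym_matrix_def)
qed

section \<open>Integration against a measure supported on a compact set\<close>

locale compact_support_measure =
  fixes B :: "'a::euclidean_space set" and \<mu> :: "'a measure"
  assumes compact: "compact B"
    and sets_eq: "sets \<mu> = sets (restrict_space borel B)"
    and finite: "finite_measure \<mu>"
    and supported: "supported_on \<mu> B"
begin

lemma space_eq: "space \<mu> = B"
  using sets_eq_imp_space_eq[OF sets_eq] by (simp add: space_restrict_space)

lemma set_integral_eq: "(LINT x:B|\<mu>. f x) = (\<integral>x. f x \<partial>\<mu>)" for f :: "'a \<Rightarrow> real"
  unfolding set_lebesgue_integral_def by (intro Bochner_Integration.integral_cong) (auto simp: space_eq)

lemma integral_cong: "(\<And>x. x \<in> B \<Longrightarrow> f x = g x) \<Longrightarrow> (\<integral>x. f x \<partial>\<mu>) = (\<integral>x. g x \<partial>\<mu>)"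
  for f g :: "'a \<Rightarrow> real"
  by (intro Bochner_Integration.integral_cong) (auto simp: space_eq)

lemma integral_nonneg: "(\<And>x. x \<in> B \<Longrightarrow> 0 \<le> f x) \<Longrightarrow> 0 \<le> (\<integral>x. f x \<partial>\<mu>)"
  for f :: "'a \<Rightarrow> real"
  by (intro Bochner_Integration.integral_nonneg) (auto simp: space_eq)

lemma measurable_continuous:
  fixes f :: "'a \<Rightarrow> real"
  assumes "continuous_on B f"
  shows "f \<in> borel_measurable \<mu>"
  using borel_measurable_continuous_on_restrict[OF assms] sets_eq
  by (simp cong: measurable_cong_sets)

lemma bounded_continuous:
  fixes f :: "'a \<Rightarrow> real"
  assumes "continuous_on B f"
  obtains C where "\<And>x. x \<in> B \<Longrightarrow> \<bar>f x\<bar> \<le> C"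
proof -
  have "bounded (f ` B)"
    by (intro compact_imp_bounded compact_continuous_image assms compact)
  then show thesis
    using that by (auto simp: bounded_iff)
qed

lemma integrable_continuous:
  fixes f :: "'a \<Rightarrow> real"
  assumes "continuous_on B f"
  shows "integrable \<mu> f"
proof -
  obtain C where "\<And>x. x \<in> B \<Longrightarrow> \<bar>f x\<bar> \<le> C"
    using bounded_continuous[OF assms] by blast
  then show ?thesis
    using measurable_continuous[OF assms]
    by (intro finite_measure.integrable_const_bound[OF finite, of _ C]) (auto simp: space_eq)
qed

lemma integral_linear_combination:
  fixes f :: "'i \<Rightarrow> 'a \<Rightarrow> real"
  assumes "\<And>i. i \<in> I \<Longrightarrow> continuous_on B (f i)"
  shows "(\<integral>x. (\<Sum>i\<in>I. c i * f i x) \<partial>\<mu>) = (\<Sum>i\<in>I. c i * (\<integral>x. f i x \<partial>\<mu>))"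
  using assms
  by (subst Bochner_Integration.integral_sum) (auto intro!: integrable_continuous continuous_intros)

text \<open>The set where \<open>h\<close> does not vanish is relatively open and is a null set, so it contains no point of \<open>B\<close>.\<close>
lemma nonneg_integral_zero_imp_zero:
  fixes h :: "'a \<Rightarrow> real"
  assumes cont: "continuous_on B h" and nonneg: "\<And>x. x \<in> B \<Longrightarrow> 0 \<le> h x"
    and int: "(\<integral>x. h x \<partial>\<mu>) \<le> 0" and "x \<in> B"
  shows "h x = 0"
proof (rule ccontr)
  assume "h x \<noteq> 0"
  define U where "U = B \<inter> h -` (- {0})"
  have "openin (top_of_set B) U"
    unfolding U_def using cont by (intro continuous_openin_preimage_gen) auto
  then have pos: "emeasure \<mu> U > 0"
    using supported \<open>x \<in> B\<close> \<open>h x \<noteq> 0\<close> by (auto simp: supported_on_def U_def)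
  have AE: "AE x in \<mu>. 0 \<le> h x"
    using nonneg by (intro AE_I2) (simp add: space_eq)
  have "(\<integral>x. h x \<partial>\<mu>) = 0"
    using int integral_nonneg[of h] nonneg by simp
  then have "AE x in \<mu>. h x = 0"
    using integral_nonneg_eq_0_iff_AE[OF integrable_continuous[OF cont] AE] by simp
  then have "AE x in \<mu>. x \<notin> U"
    by eventually_elim (simp add: U_def)
  moreover have "U = {x \<in> space \<mu>. \<not> x \<notin> U}" by (auto simp: space_eq U_def)
  moreover have "U \<in> sets \<mu>"
    using measurable_sets[OF measurable_continuous[OF cont], of "- {0}"]
    by (simp add: U_def space_eq Int_commute)
  ultimately have "emeasure \<mu> U = 0"
    using AE_iff_measurable[of U \<mu> "\<lambda>x. x \<notin> U"] by simp
  with pos show False by simp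
qed

text \<open>The inequality for squares of polynomials extends to squares of continuous functions by uniform
  approximation. Testing it with the negative part \<open>g\<close> of \<open>f\<close> makes the integrand equal to \<open>- g\<^sup>3\<close>,
  which forces \<open>g\<close> to vanish.\<close>
lemma nonneg_if_square_integrals_nonneg:
  assumes cont: "continuous_on B f"
    and squares: "\<And>p. real_polynomial_function p \<Longrightarrow> 0 \<le> (\<integral>x. f x * (p x)\<^sup>2 \<partial>\<mu>)"
    and "x \<in> B"
  shows "0 \<le> f x"
proof -
  define g where "g = (\<lambda>x. max 0 (- f x))"
  have cont_g: "continuous_on B g"
    unfolding g_def using cont by (intro continuous_intros)
  have "\<exists>p. real_polynomial_function p \<and> (\<forall>x\<in>B. \<bar>g x - p x\<bar> < 1 / real (Suc n))" for n
    using Stone_Weierstrass_real_polynomial_function[OF compact cont_g, of "1 / real (Suc n)"]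
    by (metis of_nat_0_less_iff zero_less_Suc zero_less_divide_1_iff)
  then obtain p where p: "\<And>n. real_polynomial_function (p n)"
    "\<And>n x. x \<in> B \<Longrightarrow> \<bar>g x - p n x\<bar> < 1 / real (Suc n)"
    by metis
  have cont_p: "continuous_on B (p n)" for n
    using p(1) continuous_real_polymonial_function by (auto intro: continuous_at_imp_continuous_on)
  obtain F where F: "\<And>x. x \<in> B \<Longrightarrow> \<bar>f x\<bar> \<le> F" using bounded_continuous[OF cont] by blast
  obtain G where G: "\<And>x. x \<in> B \<Longrightarrow> \<bar>g x\<bar> \<le> G" using bounded_continuous[OF cont_g] by blast
  have "(\<lambda>n. \<integral>x. f x * (p n x)\<^sup>2 \<partial>\<mu>) \<longlonglongrightarrow> (\<integral>x. f x * (g x)\<^sup>2 \<partial>\<mu>)"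
  proof (rule integral_dominated_convergence[where w = "\<lambda>x. F * (G + 1)\<^sup>2"])
    show "AE x in \<mu>. (\<lambda>n. f x * (p n x)\<^sup>2) \<longlonglongrightarrow> f x * (g x)\<^sup>2"
    proof (intro AE_I2 tendsto_intros)
      fix x assume "x \<in> space \<mu>"
      then have "x \<in> B" by (simp add: space_eq)
      have "(\<lambda>n. p n x - g x) \<longlonglongrightarrow> 0"
      proof (rule Lim_null_comparison)
        show "eventually (\<lambda>n. norm (p n x - g x) \<le> 1 / real (Suc n)) sequentially"
          using p(2)[OF \<open>x \<in> B\<close>] by (intro always_eventually allI) (simp add: abs_minus_commute less_imp_le)
        show "(\<lambda>n. 1 / real (Suc n)) \<longlonglongrightarrow> 0"
          by (rule LIMSEQ_Suc[OF lim_1_over_n])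
      qed
      then show "(\<lambda>n. p n x) \<longlonglongrightarrow> g x" by (rule LIM_zero_cancel)
    qed
    show "AE x in \<mu>. norm (f x * (p n x)\<^sup>2) \<le> F * (G + 1)\<^sup>2" for n
    proof (rule AE_I2)
      fix x assume "x \<in> space \<mu>"
      then have "x \<in> B" by (simp add: space_eq)
      have "1 / real (Suc n) \<le> 1" by simp
      then have "\<bar>p n x\<bar> \<le> G + 1"
        using p(2)[OF \<open>x \<in> B\<close>, of n] G[OF \<open>x \<in> B\<close>] by linarith
      then have "(p n x)\<^sup>2 \<le> (G + 1)\<^sup>2"
        by (metis abs_ge_zero power2_abs power_mono)
      then show "norm (f x * (p n x)\<^sup>2) \<le> F * (G + 1)\<^sup>2"
        using F[OF \<open>x \<in> B\<close>] by (simp add: abs_mult) (intro mult_mono, auto)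
    qed
  qed (use cont cont_g cont_p in \<open>auto intro!: measurable_continuous continuous_intros integrable_continuous\<close>)
  then have "0 \<le> (\<integral>x. f x * (g x)\<^sup>2 \<partial>\<mu>)"
    by (rule LIMSEQ_le_const) (use squares p(1) in auto)
  also have "(\<integral>x. f x * (g x)\<^sup>2 \<partial>\<mu>) = (\<integral>x. - ((g x) ^ 3) \<partial>\<mu>)"
    by (intro integral_cong) (simp add: g_def max_def power2_eq_square power3_eq_cube)
  finally have "(g x) ^ 3 = 0"
    using cont_g \<open>x \<in> B\<close>
    by (intro nonneg_integral_zero_imp_zero) (auto simp: g_def intro!: continuous_intros)
  then show ?thesis by (simp add: g_def max_def split: if_splits)
qed

text \<open>The Gram-Schmidt process. If the component \<open>g\<close> of a new function orthogonal to the previous ones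
  has norm zero, then it vanishes on \<open>B\<close>, so the new function is on \<open>B\<close> a combination of the previous ones
  and no vector has to be added.\<close>
lemma orthonormal_spanning_family:
  assumes lin: "\<And>f g c. f \<in> V \<Longrightarrow> g \<in> V \<Longrightarrow> (\<lambda>x. f x + c * g x) \<in> V"
    and cont: "\<And>f. f \<in> V \<Longrightarrow> continuous_on B f"
    and "finite F" and "F \<subseteq> V"
  shows "\<exists>d (e :: nat \<Rightarrow> 'a \<Rightarrow> real). (\<forall>p<d. e p \<in> V)
    \<and> (\<forall>p<d. \<forall>q<d. (\<integral>x. e p x * e q x \<partial>\<mu>) = identity_matrix p q)
    \<and> (\<forall>f\<in>F. \<exists>v. \<forall>x\<in>B. f x = (\<Sum>p<d. v p * e p x))"
  using \<open>finite F\<close> \<open>F \<subseteq> V\<close>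
proof (induction F rule: finite_induct)
  case empty
  then show ?case by (intro exI[of _ 0]) simp
next
  case (insert f F)
  from insert.prems have "F \<subseteq> V" by simp
  from insert.IH[OF this] obtain d and e :: "nat \<Rightarrow> 'a \<Rightarrow> real" where eV': "\<forall>p<d. e p \<in> V"
    and orth': "\<forall>p<d. \<forall>q<d. (\<integral>x. e p x * e q x \<partial>\<mu>) = identity_matrix p q"
    and span: "\<forall>f\<in>F. \<exists>v. \<forall>x\<in>B. f x = (\<Sum>p<d. v p * e p x)"
    by (elim exE conjE) (rule that)
  have eV: "e p \<in> V" if "p < d" for p using eV' that by blast
  have orth: "(\<integral>x. e p x * e q x \<partial>\<mu>) = identity_matrix p q" if "p < d" "q < d" for p q
    using orth' that by blast
  have fV: "f \<in> V" using insert by auto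
  define c where "c = (\<lambda>p. \<integral>x. f x * e p x \<partial>\<mu>)"
  define g where "g = (\<lambda>x. f x - (\<Sum>p<d. c p * e p x))"
  have "(\<lambda>x. f x - (\<Sum>p<m. c p * e p x)) \<in> V" if "m \<le> d" for m
    using that
  proof (induction m)
    case (Suc m)
    then have "(\<lambda>x. (f x - (\<Sum>p<m. c p * e p x)) + (- c m) * e m x) \<in> V"
      by (intro lin eV) auto
    then show ?case by (simp add: algebra_simps)
  qed (simp add: fV)
  then have gV: "g \<in> V" by (simp add: g_def)
  note [continuous_intros] = cont[OF fV] cont[OF gV] cont[OF eV]
  have orth_g: "(\<integral>x. g x * e q x \<partial>\<mu>) = 0" if "q < d" for q
  proof -
    have "(\<integral>x. g x * e q x \<partial>\<mu>) = (\<integral>x. f x * e q x - (\<Sum>p<d. c p * (e p x * e q x)) \<partial>\<mu>)"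
      by (simp add: g_def algebra_simps sum_distrib_left)
    also have "\<dots> = c q - (\<Sum>p<d. c p * identity_matrix p q)"
    proof -
      have "(\<integral>x. f x * e q x - (\<Sum>p<d. c p * (e p x * e q x)) \<partial>\<mu>) =
          (\<integral>x. f x * e q x \<partial>\<mu>) - (\<integral>x. (\<Sum>p<d. c p * (e p x * e q x)) \<partial>\<mu>)"
        using \<open>q < d\<close>
        by (intro Bochner_Integration.integral_diff integrable_continuous continuous_intros) auto
      also have "(\<integral>x. (\<Sum>p<d. c p * (e p x * e q x)) \<partial>\<mu>) =
          (\<Sum>p<d. c p * (\<integral>x. e p x * e q x \<partial>\<mu>))"
        using \<open>q < d\<close> by (intro integral_linear_combination continuous_intros) auto
      finally show ?thesis
        using \<open>q < d\<close> orth by (simp add: c_def)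
    qed
    also have "\<dots> = 0"
      using that by (simp add: identity_matrix_def if_distrib[of "\<lambda>x. _ * x"] cong: if_cong)
    finally show ?thesis .
  qed
  define N where "N = (\<integral>x. (g x)\<^sup>2 \<partial>\<mu>)"
  show ?case
  proof (cases "N \<le> 0")
    case True
    have "(g x)\<^sup>2 = 0" if "x \<in> B" for x
      using True that by (intro nonneg_integral_zero_imp_zero[of "\<lambda>x. (g x)\<^sup>2"])
        (auto simp: N_def intro!: continuous_intros)
    then have "\<forall>x\<in>B. f x = (\<Sum>p<d. c p * e p x)" by (simp add: g_def)
    then show ?thesis using eV orth span by (intro exI[of _ d] exI[of _ e]) auto
  next
    case False
    define e' where "e' = e(d := \<lambda>x. g x / sqrt N)"
    have old: "e' p = e p" if "p < d" for p using that by (simp add: e'_def)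
    have new: "e' d = (\<lambda>x. g x / sqrt N)" by (simp add: e'_def)
    have "(\<lambda>x. g x + (1 / sqrt N - 1) * g x) \<in> V" by (intro lin gV)
    then have "e' d \<in> V" by (simp add: new algebra_simps)
    moreover have "(\<integral>x. e' d x * e' d x \<partial>\<mu>) = 1"
    proof -
      have "(\<integral>x. e' d x * e' d x \<partial>\<mu>) = (\<integral>x. (g x)\<^sup>2 / N \<partial>\<mu>)"
        using False by (simp add: new power2_eq_square)
      then show ?thesis using False by (simp add: N_def[symmetric])
    qed
    moreover have "(\<integral>x. e' d x * e' q x \<partial>\<mu>) = 0" "(\<integral>x. e' q x * e' d x \<partial>\<mu>) = 0" if "q < d" for q
      using orth_g[OF that] by (simp_all add: new old that mult.commute)
    ultimately have "\<forall>p<Suc d. e' p \<in> V"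
      "\<forall>p<Suc d. \<forall>q<Suc d. (\<integral>x. e' p x * e' q x \<partial>\<mu>) = identity_matrix p q"
      using eV orth by (auto simp: less_Suc_eq old identity_matrix_def)
    moreover have "\<exists>v. \<forall>x\<in>B. h x = (\<Sum>p<Suc d. v p * e' p x)" if "h \<in> insert f F" for h
    proof (cases "h = f")
      case True
      have "(\<Sum>p<Suc d. (c(d := sqrt N)) p * e' p x) = f x" for x
        using False by (simp add: new old g_def)
      then show ?thesis unfolding True by metis
    next
      case F: False
      then obtain v where "\<forall>x\<in>B. h x = (\<Sum>p<d. v p * e p x)" using span \<open>h \<in> insert f F\<close> by auto
      then show ?thesis
        by (intro exI[of _ "v(d := 0)"]) (simp add: old)
    qed
    ultimately show ?thesis by blast
  qed
qed

end

section \<open>Relaxations by squares of bounded degree\<close>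

locale moment_relaxation = compact_support_measure B \<mu>
  for B :: "(real^'n) set" and \<mu> :: "(real^'n) measure" +
  fixes T :: "real^'n \<Rightarrow> real^'m"
  assumes continuous_T: "continuous_on B T"
begin

lemma continuous_T_component [continuous_intros]: "continuous_on B (\<lambda>x. T x $ i)"
  using continuous_T by (intro continuous_intros)

lemma Q_iff:
  "l \<in> Q B \<mu> T k \<longleftrightarrow>
     (\<forall>a\<in>polys_deg_le k. 0 \<le> (\<integral>x. (1 + (\<Sum>i\<in>UNIV. l $ i * T x $ i)) * (a x)\<^sup>2 \<partial>\<mu>))"
  by (simp add: Q_def psd_form_on_def phi_def set_integral_eq power2_eq_square mult.assoc)

lemma Q_decreasing: "j \<le> k \<Longrightarrow> Q B \<mu> T k \<subseteq> Q B \<mu> T j"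
  using polys_deg_le_mono[of j k] by (fastforce simp: Q_iff)

lemma polar_image_iff: "l \<in> polar (T ` B) \<longleftrightarrow> (\<forall>x\<in>B. 0 \<le> 1 + (\<Sum>i\<in>UNIV. l $ i * T x $ i))"
  by (auto simp: polar_def algebra_simps minus_le_iff)

lemma polar_image_subset_Q: "polar (T ` B) \<subseteq> Q B \<mu> T k"
  by (auto simp: Q_iff polar_image_iff intro!: integral_nonneg)

text \<open>The form depends on polynomials only through their restrictions to \<open>B\<close>, so it is represented by
  its matrix with respect to orthonormal polynomials spanning these restrictions. Orthonormality makes the
  constant term of the matrix the identity.\<close>
lemma Q_monic_spectrahedron:
  "\<exists>d M. (\<forall>i. sym_matrix d (M i)) \<and> Q B \<mu> T k = monic_spectrahedron d M"
proof -
  define F :: "(real^'n \<Rightarrow> real) set"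
    where "F = monomial_fun ` {\<alpha>. (\<Sum>i\<in>UNIV. \<alpha> i) \<le> k}"
  have "finite F" "F \<subseteq> polys_deg_le k"
    by (auto simp: F_def finite_exponents monomial_in_polys_deg_le)
  then have "\<exists>d (e :: nat \<Rightarrow> real^'n \<Rightarrow> real). (\<forall>p<d. e p \<in> polys_deg_le k)
      \<and> (\<forall>p<d. \<forall>q<d. (\<integral>x. e p x * e q x \<partial>\<mu>) = identity_matrix p q)
      \<and> (\<forall>f\<in>F. \<exists>v. \<forall>x\<in>B. f x = (\<Sum>p<d. v p * e p x))"
    by (intro orthonormal_spanning_family polys_deg_le_add_scaled continuous_on_polys_deg_le)
  then obtain d and e :: "nat \<Rightarrow> real^'n \<Rightarrow> real" where eV': "\<forall>p<d. e p \<in> polys_deg_le k"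
    and orth: "\<forall>p<d. \<forall>q<d. (\<integral>x. e p x * e q x \<partial>\<mu>) = identity_matrix p q"
    and span: "\<forall>f\<in>F. \<exists>v. \<forall>x\<in>B. f x = (\<Sum>p<d. v p * e p x)"
    by (elim exE conjE) (rule that)
  have eV: "e p \<in> polys_deg_le k" if "p < d" for p using eV' that by blast
  note [continuous_intros] = continuous_on_polys_deg_le[OF eV]
  have coords: "\<exists>v. \<forall>x\<in>B. a x = (\<Sum>p<d. v p * e p x)" if "a \<in> polys_deg_le k" for a
  proof -
    obtain c where a: "a = (\<lambda>x. \<Sum>\<alpha> | (\<Sum>i\<in>UNIV. \<alpha> i) \<le> k. c \<alpha> * monomial_fun \<alpha> x)"
      using \<open>a \<in> polys_deg_le k\<close> unfolding polys_deg_le_iff by blast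
    have "\<forall>\<alpha>. \<exists>v. (\<Sum>i\<in>UNIV. \<alpha> i) \<le> k \<longrightarrow> (\<forall>x\<in>B. monomial_fun \<alpha> x = (\<Sum>p<d. v p * e p x))"
      using span unfolding F_def by blast
    from choice[OF this] obtain v where v: "\<And>\<alpha> x. (\<Sum>i\<in>UNIV. \<alpha> i) \<le> k \<Longrightarrow> x \<in> B \<Longrightarrow>
        monomial_fun \<alpha> x = (\<Sum>p<d. v \<alpha> p * e p x)"
      by blast
    define u where "u = (\<lambda>p. \<Sum>\<alpha> | (\<Sum>i\<in>UNIV. \<alpha> i) \<le> k. c \<alpha> * v \<alpha> p)"
    have "a x = (\<Sum>p<d. u p * e p x)" if "x \<in> B" for x
    proof -
      have "a x = (\<Sum>\<alpha> | (\<Sum>i\<in>UNIV. \<alpha> i) \<le> k. \<Sum>p<d. c \<alpha> * v \<alpha> p * e p x)"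
        unfolding a using that by (intro sum.cong) (auto simp: v sum_distrib_left mult.assoc)
      also have "\<dots> = (\<Sum>p<d. \<Sum>\<alpha> | (\<Sum>i\<in>UNIV. \<alpha> i) \<le> k. c \<alpha> * v \<alpha> p * e p x)"
        by (rule sum.swap)
      finally show ?thesis by (simp add: u_def sum_distrib_right)
    qed
    then show ?thesis by (intro exI[of _ u]) simp
  qed
  define M where "M = (\<lambda>i p q. \<integral>x. T x $ i * (e p x * e q x) \<partial>\<mu>)"
  have sym: "sym_matrix d (M i)" for i
    by (simp add: sym_matrix_def M_def mult.commute)
  \<comment> \<open>The matrix inequality at the coefficient vector \<open>v\<close> is the integral inequality for the polynomial
    with these coefficients.\<close>
  have quad: "(\<integral>x. (1 + (\<Sum>i\<in>UNIV. l $ i * T x $ i)) * (\<Sum>p<d. v p * e p x)\<^sup>2 \<partial>\<mu>) =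
      quad_form d (\<lambda>p q. identity_matrix p q + (\<Sum>i\<in>UNIV. l $ i * M i p q)) v" for l v
  proof -
    have entry: "(\<integral>x. (1 + (\<Sum>i\<in>UNIV. l $ i * T x $ i)) * (e p x * e q x) \<partial>\<mu>) =
        identity_matrix p q + (\<Sum>i\<in>UNIV. l $ i * M i p q)" if "p < d" "q < d" for p q
    proof -
      have "(\<integral>x. (1 + (\<Sum>i\<in>UNIV. l $ i * T x $ i)) * (e p x * e q x) \<partial>\<mu>) =
          (\<integral>x. e p x * e q x + (\<Sum>i\<in>UNIV. l $ i * (T x $ i * (e p x * e q x))) \<partial>\<mu>)"
        by (simp add: distrib_right sum_distrib_right mult.assoc)
      also have "\<dots> = (\<integral>x. e p x * e q x \<partial>\<mu>)
          + (\<integral>x. (\<Sum>i\<in>UNIV. l $ i * (T x $ i * (e p x * e q x))) \<partial>\<mu>)"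
        using that by (intro Bochner_Integration.integral_add integrable_continuous continuous_intros)
      also have "(\<integral>x. (\<Sum>i\<in>UNIV. l $ i * (T x $ i * (e p x * e q x))) \<partial>\<mu>) =
          (\<Sum>i\<in>UNIV. l $ i * M i p q)"
        unfolding M_def using that by (intro integral_linear_combination continuous_intros)
      finally show ?thesis using orth that by simp
    qed
    have "(\<integral>x. (1 + (\<Sum>i\<in>UNIV. l $ i * T x $ i)) * (\<Sum>p<d. v p * e p x)\<^sup>2 \<partial>\<mu>) =
        (\<integral>x. (\<Sum>p<d. 1 * (\<Sum>q<d. v p * v q *
            ((1 + (\<Sum>i\<in>UNIV. l $ i * T x $ i)) * (e p x * e q x)))) \<partial>\<mu>)"
      by (simp add: power2_eq_square sum_product sum_distrib_left mult_ac)
    also have "\<dots> = (\<Sum>p<d. 1 * (\<integral>x. (\<Sum>q<d. v p * v q *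
        ((1 + (\<Sum>i\<in>UNIV. l $ i * T x $ i)) * (e p x * e q x))) \<partial>\<mu>))"
      by (intro integral_linear_combination continuous_intros) auto
    also have "\<dots> = (\<Sum>p<d. \<Sum>q<d. v p * v q *
        (\<integral>x. (1 + (\<Sum>i\<in>UNIV. l $ i * T x $ i)) * (e p x * e q x) \<partial>\<mu>))"
      unfolding mult_1
      by (intro sum.cong refl integral_linear_combination continuous_intros) auto
    also have "\<dots> = quad_form d (\<lambda>p q. identity_matrix p q + (\<Sum>i\<in>UNIV. l $ i * M i p q)) v"
      unfolding quad_form_def by (intro sum.cong refl) (simp add: entry)
    finally show ?thesis .
  qed
  have "l \<in> Q B \<mu> T k \<longleftrightarrow> l \<in> monic_spectrahedron d M" for l
  proof
    assume l: "l \<in> Q B \<mu> T k"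
    have "(\<lambda>x. \<Sum>p<d. v p * e p x) \<in> polys_deg_le k" for v
      by (intro polys_deg_le_sum eV) auto
    with l have "0 \<le> quad_form d (\<lambda>p q. identity_matrix p q + (\<Sum>i\<in>UNIV. l $ i * M i p q)) v" for v
      unfolding Q_iff by (simp add: quad[symmetric])
    moreover have "sym_matrix d (\<lambda>p q. identity_matrix p q + (\<Sum>i\<in>UNIV. l $ i * M i p q))"
      using sym by (auto simp: sym_matrix_def identity_matrix_def)
    ultimately show "l \<in> monic_spectrahedron d M"
      by (simp add: monic_spectrahedron_def psd_matrix_iff)
  next
    assume l: "l \<in> monic_spectrahedron d M"
    show "l \<in> Q B \<mu> T k"
      unfolding Q_iff
    proof
      fix a :: "real^'n \<Rightarrow> real" assume "a \<in> polys_deg_le k"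
      then obtain v where v: "\<And>x. x \<in> B \<Longrightarrow> a x = (\<Sum>p<d. v p * e p x)"
        using coords by blast
      have "(\<integral>x. (1 + (\<Sum>i\<in>UNIV. l $ i * T x $ i)) * (a x)\<^sup>2 \<partial>\<mu>) =
          (\<integral>x. (1 + (\<Sum>i\<in>UNIV. l $ i * T x $ i)) * (\<Sum>p<d. v p * e p x)\<^sup>2 \<partial>\<mu>)"
        by (intro integral_cong) (simp add: v)
      also have "\<dots> \<ge> 0"
        using l unfolding quad by (simp add: monic_spectrahedron_def psd_matrix_iff)
      finally show "0 \<le> (\<integral>x. (1 + (\<Sum>i\<in>UNIV. l $ i * T x $ i)) * (a x)\<^sup>2 \<partial>\<mu>)" .
    qed
  qed
  with sym show ?thesis by blast
qed

lemma spectrahedron_Q: "spectrahedron (Q B \<mu> T k)"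
  using Q_monic_spectrahedron[of k] spectrahedron_monic by metis

lemma SDR_set_polar_Q: "SDR_set (polar (Q B \<mu> T k))"
  using Q_monic_spectrahedron[of k] SDR_set_polar_monic_spectrahedron by metis

text \<open>\<open>Q\<^sub>k\<close> is itself a polar, hence closed, convex and containing the origin.\<close>
lemma bipolar_Q: "polar (polar (Q B \<mu> T k)) = Q B \<mu> T k"
proof -
  obtain d M where "\<forall>i. sym_matrix d (M i)" and Q: "Q B \<mu> T k = monic_spectrahedron d M"
    using Q_monic_spectrahedron[of k] by blast
  then have "Q B \<mu> T k = polar (numerical_range d M)"
    by (simp add: monic_spectrahedron_eq_polar)
  then show ?thesis
    by (simp add: bipolar closed_convex_polar zero_in_polar)
qed

lemma INT_Q_eq_polar: "(\<Inter>k\<in>{j..}. Q B \<mu> T k) = polar (T ` B)"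
proof
  show "polar (T ` B) \<subseteq> (\<Inter>k\<in>{j..}. Q B \<mu> T k)"
    using polar_image_subset_Q by blast
  show "(\<Inter>k\<in>{j..}. Q B \<mu> T k) \<subseteq> polar (T ` B)"
  proof
    fix l assume l: "l \<in> (\<Inter>k\<in>{j..}. Q B \<mu> T k)"
    have "0 \<le> (\<integral>x. (1 + (\<Sum>i\<in>UNIV. l $ i * T x $ i)) * (p x)\<^sup>2 \<partial>\<mu>)"
      if p: "real_polynomial_function p" for p
    proof -
      obtain k where "p \<in> polys_deg_le k"
        using real_polynomial_function_in_polys_deg_le[OF p] by blast
      then have "p \<in> polys_deg_le (max j k)" using polys_deg_le_mono[of k "max j k"] by auto
      moreover have "l \<in> Q B \<mu> T (max j k)" using l by simp
      ultimately show ?thesis by (simp add: Q_iff)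
    qed
    then show "l \<in> polar (T ` B)"
      unfolding polar_image_iff
      by (intro ballI nonneg_if_square_integrals_nonneg[of "\<lambda>x. 1 + (\<Sum>i\<in>UNIV. l $ i * T x $ i)"])
         (auto intro!: continuous_intros)
  qed
qed

text \<open>The bipolar always contains the origin, hence the hypothesis; compactness of \<open>B\<close> makes
  the hull closed.\<close>
lemma bipolar_image:
  assumes "0 \<in> convex hull (T ` B)"
  shows "polar (polar (T ` B)) = convex hull (T ` B)"
proof -
  have "polar (polar (convex hull (T ` B))) = convex hull (T ` B)"
    using assms compact_convex_hull[OF compact_continuous_image[OF continuous_T compact]]
    by (intro bipolar compact_imp_closed convex_convex_hull)
  then show ?thesis by (simp add: polar_convex_hull)
qed

text \<open>Both sides are closed convex sets containing the origin, so it suffices to compare their polars.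
  The polar of a union is the intersection of the polars, that is, of the sets \<open>Q\<^sub>k\<close>.\<close>
lemma closure_UN_polar_Q:
  assumes "0 \<in> convex hull (T ` B)"
  shows "closure (\<Union>k. polar (Q B \<mu> T k)) = convex hull (T ` B)"
proof -
  let ?U = "\<Union>k. polar (Q B \<mu> T k)"
  have incr: "polar (Q B \<mu> T j) \<subseteq> polar (Q B \<mu> T k)" if "j \<le> k" for j k
    using that by (intro polar_antimono Q_decreasing)
  have "convex ?U"
  proof (rule convexI)
    fix x y and s t :: real
    assume "x \<in> ?U" "y \<in> ?U" and st: "0 \<le> s" "0 \<le> t" "s + t = 1"
    then obtain j k where "x \<in> polar (Q B \<mu> T j)" "y \<in> polar (Q B \<mu> T k)" by blast
    then have "x \<in> polar (Q B \<mu> T (max j k))" "y \<in> polar (Q B \<mu> T (max j k))"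
      using incr[of j "max j k"] incr[of k "max j k"] by auto
    then show "s *\<^sub>R x + t *\<^sub>R y \<in> ?U"
      using st convexD[OF closed_convex_polar(2)] by blast
  qed
  moreover have "0 \<in> closure ?U"
    by (rule subsetD[OF closure_subset]) (simp add: zero_in_polar)
  ultimately have "closure ?U = polar (polar (closure ?U))"
    by (intro bipolar[symmetric] convex_closure) auto
  also have "polar (closure ?U) = polar ?U"
    by (rule polar_closure)
  also have "\<dots> = (\<Inter>k\<in>{0..}. polar (polar (Q B \<mu> T k)))"
    by (simp add: polar_UN)
  also have "\<dots> = polar (T ` B)"
    by (simp only: bipolar_Q INT_Q_eq_polar)
  also have "polar \<dots> = convex hull (T ` B)"
    by (rule bipolar_image[OF assms])
  finally show ?thesis .
qed

end

lemma real_polynomial_function_separating_point: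
  fixes B :: "'a::euclidean_space set"
  assumes "finite B"
  shows "\<exists>p. real_polynomial_function p \<and> (\<forall>y\<in>B. p y = 0 \<longleftrightarrow> y \<noteq> x)"
proof -
  have square: "real_polynomial_function (\<lambda>z :: 'a. (z - y) \<bullet> (z - y))" for y
  proof -
    have eq: "(\<lambda>z. (z - y) \<bullet> (z - y)) = (\<lambda>z. \<Sum>b\<in>Basis. (z \<bullet> b - y \<bullet> b) ^ 2)"
      by (subst euclidean_inner) (simp add: inner_diff_left power2_eq_square)
    show ?thesis
      unfolding eq
      by (intro real_polynomial_function_sum real_polynomial_function_power
          real_polynomial_function_diff real_polynomial_function.intros bounded_linear_inner_left) simp
  qed
  define p where "p = (\<lambda>z. \<Prod>y\<in>B - {x}. (z - y) \<bullet> (z - y))"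
  have "real_polynomial_function p"
    unfolding p_def
    using assms
    by (intro real_polynomial_function_prod square) simp
  moreover have "\<forall>y\<in>B. p y = 0 \<longleftrightarrow> y \<noteq> x"
    using assms by (auto simp: p_def)
  ultimately show ?thesis by blast
qed

text \<open>If the degree admits, for each point of \<open>B\<close>, a polynomial that vanishes at exactly the other points, then the
  integral against its square is a positive multiple of the value of \<open>1 + \<Sum>\<^sub>i l\<^sub>i T\<^sub>i\<close> at that point.\<close>
lemma (in moment_relaxation) Q_eq_polar_finite:
  assumes B: "finite B" and \<mu>: "\<mu> = count_space B"
  shows "\<exists>k. Q B \<mu> T k = polar (T ` B)"
proof -
  obtain p where p: "\<And>x. real_polynomial_function (p x)" "\<And>x y. y \<in> B \<Longrightarrow> p x y = 0 \<longleftrightarrow> y \<noteq> x"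
    using real_polynomial_function_separating_point[OF B] by metis
  have "\<exists>k. p x \<in> polys_deg_le k" for x
    by (intro real_polynomial_function_in_polys_deg_le p)
  then obtain deg where deg: "\<And>x. p x \<in> polys_deg_le (deg x)"
    by metis
  \<comment> \<open>Any common upper bound of the degrees would do.\<close>
  define k where "k = (\<Sum>x\<in>B. deg x)"
  have pk: "p x \<in> polys_deg_le k" if "x \<in> B" for x
    using deg[of x] polys_deg_le_mono[of "deg x" k] member_le_sum[of x B deg] B that
    by (auto simp: k_def)
  have "Q B \<mu> T k \<subseteq> polar (T ` B)"
  proof
    fix l assume l: "l \<in> Q B \<mu> T k"
    define f where "f = (\<lambda>x. 1 + (\<Sum>i\<in>UNIV. l $ i * T x $ i))"
    have "0 \<le> f x" if "x \<in> B" for x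
    proof -
      have "0 \<le> (\<integral>y. f y * (p x y)\<^sup>2 \<partial>\<mu>)"
        using l pk[OF that] by (simp add: Q_iff f_def)
      also have "\<dots> = (\<Sum>y\<in>B. f y * (p x y)\<^sup>2)"
        unfolding \<mu> by (rule lebesgue_integral_count_space_finite[OF B])
      also have "\<dots> = (\<Sum>y\<in>{x}. f y * (p x y)\<^sup>2)"
        using B that p(2) by (intro sum.mono_neutral_right) auto
      finally show ?thesis
        using p(2)[OF that, of x] by (simp add: zero_le_mult_iff)
    qed
    then show "l \<in> polar (T ` B)" by (simp add: polar_image_iff f_def)
  qed
  with polar_image_subset_Q show ?thesis by blast
qed

section \<open>Convex hulls of polynomial images\<close>

theorem lemma4p1:
  fixes B :: "(real^'n) set"
    and \<mu> :: "(real^'n) measure"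
    and T :: "real^'n \<Rightarrow> real^'m"
  assumes "compact B"
    and "sets \<mu> = sets (restrict_space borel B)"
    and "finite_measure \<mu>"
    and "supported_on \<mu> B"
    and "polynomial_function T"
  shows "(\<forall>k. Q B \<mu> T (Suc k) \<subseteq> Q B \<mu> T k \<and> spectrahedron (Q B \<mu> T k)
              \<and> SDR_set (polar (Q B \<mu> T k)))
       \<and> (\<forall>k. polar (convex hull (T ` B)) \<subseteq> Q B \<mu> T k)
       \<and> polar (convex hull (T ` B)) = (\<Inter>k\<in>{1..}. Q B \<mu> T k)
       \<and> (0 \<in> convex hull (T ` B) \<longrightarrow>
            convex hull (T ` B) = closure (\<Union>k. polar (Q B \<mu> T k)))
       \<and> (0 \<in> convex hull (T ` B) \<and> finite B \<and> \<mu> = count_space B \<longrightarrow>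
            (\<exists>k. convex hull (T ` B) = polar (Q B \<mu> T k)))"
proof -
  interpret moment_relaxation B \<mu> T
    using assms continuous_on_polymonial_function[of T B]
    by (intro moment_relaxation.intro compact_support_measure.intro moment_relaxation_axioms.intro)
  have "\<exists>k. convex hull (T ` B) = polar (Q B \<mu> T k)"
    if "0 \<in> convex hull (T ` B)" "finite B" "\<mu> = count_space B"
    using Q_eq_polar_finite[OF that(2,3)] bipolar_image[OF that(1)] by metis
  then show ?thesis
    unfolding polar_convex_hull INT_Q_eq_polar
    by (intro conjI allI impI Q_decreasing spectrahedron_Q SDR_set_polar_Q polar_image_subset_Q
        closure_UN_polar_Q[symmetric]) auto
qed

end
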